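(* Let $\rho,H\in\mathcal B$ and let $\Phi_\theta$ be the layered quantum channel of the context with intermediate quantum channels $\mathcal E_1,\dots,\mathcal E_L$. Then $$\mathbb E_\theta\left\{\mathrm{Tr}[\Phi_\theta(\rho)H]^2\right\}=\Big(\ell_\rho,\ \prod_{l=1}^LT_l\,\ell_H\Big),$$ where $\prod_{l=1}^LT_l=T_1T_2\cdots T_L$ and each $T_l$ is the locality transfer matrix associated to $\mathcal E_l^\dagger$.
   Context: Locality. Let $\mathcal H=\bigotimes_{m=1}^M\mathcal H_m$ be the Hilbert space of $n$ qubits, $d=\dim\mathcal H=2^n$, where each $\mathcal H_m$ (of dimension $d_m$) is a single qubit or a group of qubits. Let $\mathcal B$ be the space of linear operators on $\mathcal H$. For $\kappa\in\{0,1\}^M$ let $\mathcal B_\kappa\subset\mathcal B$ be the span of the operators $\bigotimes_m A_m$ with $A_m=\mathbb 1$ if $\kappa_m=0$ and $\mathrm{Tr}[A_m]=0$ if $\kappa_m=1$. Then $\mathcal B=\bigoplus_\kappa\mathcal B_\kappa$ and $d_\kappa:=\dim\mathcal B_\kappa=\prod_m(d_m^2-1)^{\kappa_m}$. For $A\in\mathcal B$ the locality vector $\ell_A$, indexed by $\{0,1\}^M$, is $(\ell_A)_\kappa=\sum_{j=1}^{d_\kappa}\mathrm{Tr}[B_jA]^2$, for any basis $\{B_j\}$ of $\mathcal B_\kappa$ consisting of Hermitian operators and orthonormal for the Hilbert–Schmidt product (the value does not depend on the basis; it is real when $A$ is Hermitian). The locality transfer matrix (LTM) of a linear map $\Lambda:\mathcal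 B\to\mathcal B$ is $T_{\kappa,\lambda}=\frac1{d_\lambda}\sum_{j=1}^{d_\lambda}(\ell_{\Lambda(B_j)})_\kappa$, with $\{B_j\}$ a Hermitian orthonormal basis of $\mathcal B_\lambda$. For vectors indexed by $\{0,1\}^M$, $(a,b)=\sum_\kappa a_\kappa b_\kappa/d_\kappa$. $\mathcal E^\dagger$ is the Hilbert–Schmidt adjoint of $\mathcal E$. Circuit. $\Phi_\theta=\mathcal U_{\theta_{L+1}}\circ\mathcal E_L\circ\mathcal U_{\theta_L}\circ\cdots\circ\mathcal E_1\circ\mathcal U_{\theta_1}$, where each $\mathcal E_l$ is a quantum channel (completely positive, trace preserving linear map $\mathcal B\to\mathcal B$) and $\mathcal U_{\theta_l}(\rho)=U_{\theta_l}\rho U_{\theta_l}^\dagger$ with $U_{\theta_l}=\bigotimes_m U^{(m)}_{\theta_l}$. The random unitaries $U^{(m)}_{\theta_l}$ are independent over all $l$ and $m$, and each forms a unitary $2$-design on $U(d_m)$: $\mathbb E[U^{\otimes2}\otimes (U^{*})^{\otimes 2}]$ equals the corresponding Haar average over $U(d_m)$. *)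

theory Defs
  imports "HOL-Probability.Probability"
begin

section \<open>Complex matrices\<close>

definition cscale :: "complex \<Rightarrow> complex^'n^'m \<Rightarrow> complex^'n^'m" where
  "cscale c A = (\<chi> i j. c * A $ i $ j)"

global_interpretation cmat: vector_space cscale
  by unfold_locales (simp_all add: cscale_def vec_eq_iff algebra_simps)

definition cconj :: "complex^'n^'m \<Rightarrow> complex^'n^'m" where
  "cconj A = (\<chi> i j. cnj (A $ i $ j))"

definition dagger :: "complex^'n^'m \<Rightarrow> complex^'m^'n" where
  "dagger A = transpose (cconj A)"

definition hs_inner :: "complex^'n^'n \<Rightarrow> complex^'n^'n \<Rightarrow> complex" where
  "hs_inner A B = trace (dagger A ** B)"

definition kron :: "complex^'i^'i \<Rightarrow> complex^'j^'j \<Rightarrow> complex^('i \<times> 'j)^('i \<times> 'j)" where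
  "kron A B = (\<chi> x y. A $ fst x $ fst y * B $ snd x $ snd y)"

definition linear_map :: "(complex^'n^'n \<Rightarrow> complex^'n^'n) \<Rightarrow> bool" where
  "linear_map = Vector_Spaces.linear cscale cscale"

definition hs_adjoint ::
  "(complex^'n^'n \<Rightarrow> complex^'n^'n) \<Rightarrow> complex^'n^'n \<Rightarrow> complex^'n^'n" where
  "hs_adjoint \<Lambda> = (THE F. \<forall>A B. hs_inner (F A) B = hs_inner A (\<Lambda> B))"

section \<open>Quantum channels\<close>

text \<open>A family \<open>X a b\<close> with \<open>a, b < k\<close> represents the \<open>k \<times> k\<close> block matrix
  \<open>\<Sum>\<^sub>a\<^sub>b E\<^sub>a\<^sub>b \<otimes> X a b\<close>, on which \<open>id\<^sub>k \<otimes> \<Lambda>\<close> acts blockwise.\<close>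

definition block_psd :: "nat \<Rightarrow> (nat \<Rightarrow> nat \<Rightarrow> complex^'n^'n) \<Rightarrow> bool" where
  "block_psd k X \<longleftrightarrow> (\<forall>v :: nat \<Rightarrow> complex^'n.
     (\<Sum>a<k. \<Sum>b<k. \<Sum>i\<in>UNIV. cnj (v a $ i) * (X a b *v v b) $ i) \<in> \<real>\<^sub>\<ge>\<^sub>0)"

definition completely_positive :: "(complex^'n^'n \<Rightarrow> complex^'n^'n) \<Rightarrow> bool" where
  "completely_positive \<Lambda> \<longleftrightarrow>
     (\<forall>k X. block_psd k X \<longrightarrow> block_psd k (\<lambda>a b. \<Lambda> (X a b)))"

definition quantum_channel :: "(complex^'n^'n \<Rightarrow> complex^'n^'n) \<Rightarrow> bool" where
  "quantum_channel \<E> \<longleftrightarrow>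
     linear_map \<E> \<and> completely_positive \<E> \<and> (\<forall>A. trace (\<E> A) = trace A)"

section \<open>Qubits and groups of qubits\<close>

text \<open>The finite type \<open>'q\<close> labels the qubits. A bit string, i.e. a computational basis
  vector, is encoded as the set of those qubits whose bit is 1, so that \<open>\<B>\<close> is the type
  of matrices indexed by \<open>'q set\<close>. The Hilbert space of a subset \<open>S\<close> of the qubits has the
  basis \<open>Pow S\<close>; its operators are the matrices whose entries vanish outside
  \<open>Pow S \<times> Pow S\<close>, and their unit is \<open>id_on S\<close>.\<close>

type_synonym 'q qop = "complex^('q set)^('q set)"

definition ops_on :: "'q::finite set \<Rightarrow> 'q qop set" where
  "ops_on S = {A. \<forall>x y. A $ x $ y \<noteq> 0 \<longrightarrow> x \<subseteq> S \<and> y \<subseteq> S}"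

definition id_on :: "'q::finite set \<Rightarrow> 'q qop" where
  "id_on S = (\<chi> x y. if x = y \<and> x \<subseteq> S then 1 else 0)"

definition unitary_group :: "'q::finite set \<Rightarrow> 'q qop set" where
  "unitary_group S = {U \<in> ops_on S. dagger U ** U = id_on S \<and> U ** dagger U = id_on S}"

text \<open>A function \<open>g :: 'q \<Rightarrow> 'm\<close> assigns to each qubit the tensor factor containing it.
  A bit string \<open>x\<close> restricts to the bit string \<open>x \<inter> grp g m\<close> of the factor \<open>m\<close>.\<close>

definition grp :: "('q \<Rightarrow> 'm) \<Rightarrow> 'm \<Rightarrow> 'q set" where
  "grp g m = {q. g q = m}"

definition tensor :: "('q::finite \<Rightarrow> 'm::finite) \<Rightarrow> ('m \<Rightarrow> 'q qop) \<Rightarrow> 'q qop" where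
  "tensor g A = (\<chi> x y. \<Prod>m\<in>UNIV. A m $ (x \<inter> grp g m) $ (y \<inter> grp g m))"

section \<open>Locality\<close>

definition loc_space :: "('q::finite \<Rightarrow> 'm::finite) \<Rightarrow> ('m \<Rightarrow> bool) \<Rightarrow> 'q qop set" where
  "loc_space g \<kappa> = cmat.span {tensor g A | A. \<forall>m. A m \<in> ops_on (grp g m) \<and>
     (if \<kappa> m then trace (A m) = 0 else A m = id_on (grp g m))}"

definition loc_dim :: "('q::finite \<Rightarrow> 'm::finite) \<Rightarrow> ('m \<Rightarrow> bool) \<Rightarrow> nat" where
  "loc_dim g \<kappa> = cmat.dim (loc_space g \<kappa>)"

definition hermitian_onb :: "(complex^'n^'n) set \<Rightarrow> (complex^'n^'n) set \<Rightarrow> bool" where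
  "hermitian_onb V S \<longleftrightarrow> cmat.independent S \<and> cmat.span S = V \<and>
     (\<forall>B\<in>S. dagger B = B) \<and> (\<forall>B\<in>S. \<forall>C\<in>S. hs_inner B C = (if B = C then 1 else 0))"

definition herm_basis :: "('q::finite \<Rightarrow> 'm::finite) \<Rightarrow> ('m \<Rightarrow> bool) \<Rightarrow> 'q qop set" where
  "herm_basis g \<kappa> = (SOME S. hermitian_onb (loc_space g \<kappa>) S)"

definition locality_vector ::
  "('q::finite \<Rightarrow> 'm::finite) \<Rightarrow> 'q qop \<Rightarrow> complex^('m \<Rightarrow> bool)" where
  "locality_vector g A = (\<chi> \<kappa>. \<Sum>B\<in>herm_basis g \<kappa>. (trace (B ** A))\<^sup>2)"

definition ltm ::
  "('q::finite \<Rightarrow> 'm::finite) \<Rightarrow> ('q qop \<Rightarrow> 'q qop) \<Rightarrow> complex^('m \<Rightarrow> bool)^('m \<Rightarrow> bool)" where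
  "ltm g \<Lambda> = (\<chi> \<kappa> \<nu>. 1 / of_nat (loc_dim g \<nu>) *
     (\<Sum>B\<in>herm_basis g \<nu>. locality_vector g (\<Lambda> B) $ \<kappa>))"

definition loc_inner ::
  "('q::finite \<Rightarrow> 'm::finite) \<Rightarrow> complex^('m \<Rightarrow> bool) \<Rightarrow> complex^('m \<Rightarrow> bool) \<Rightarrow> complex" where
  "loc_inner g a b = (\<Sum>\<kappa>\<in>UNIV. a $ \<kappa> * b $ \<kappa> / of_nat (loc_dim g \<kappa>))"

section \<open>Unitary 2-designs\<close>

definition haar_measure :: "'q::finite set \<Rightarrow> 'q qop measure \<Rightarrow> bool" where
  "haar_measure S \<mu> \<longleftrightarrow> prob_space \<mu> \<and>
     space \<mu> = unitary_group S \<and> sets \<mu> = sets (restrict_space borel (unitary_group S)) \<and>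
     (\<forall>V\<in>unitary_group S. distr \<mu> \<mu> (\<lambda>U. V ** U) = \<mu> \<and> distr \<mu> \<mu> (\<lambda>U. U ** V) = \<mu>)"

text \<open>The Haar measure is the unique \<open>\<mu>\<close> satisfying \<open>haar_measure S \<mu>\<close>; the existential
  quantifier below stands for it, since the library provides no Haar measure.\<close>

definition unitary_2_design :: "'q::finite set \<Rightarrow> 'w measure \<Rightarrow> ('w \<Rightarrow> 'q qop) \<Rightarrow> bool" where
  "unitary_2_design S P U \<longleftrightarrow> U \<in> borel_measurable P \<and>
     (\<forall>\<omega>\<in>space P. U \<omega> \<in> unitary_group S) \<and>
     (\<exists>\<mu>. haar_measure S \<mu> \<and>
       (\<integral>\<omega>. kron (kron (U \<omega>) (U \<omega>)) (kron (cconj (U \<omega>)) (cconj (U \<omega>))) \<partial>P) =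
       (\<integral>V. kron (kron V V) (kron (cconj V) (cconj V)) \<partial>\<mu>))"

section \<open>Layered channels\<close>

definition conjugation :: "complex^'n^'n \<Rightarrow> complex^'n^'n \<Rightarrow> complex^'n^'n" where
  "conjugation U \<rho> = U ** \<rho> ** dagger U"

text \<open>The layers are numbered from 1: \<open>layered \<E> U L\<close> is
  \<open>\<U>\<^sub>L\<^sub>+\<^sub>1 \<circ> \<E>\<^sub>L \<circ> \<U>\<^sub>L \<circ> \<dots> \<circ> \<E>\<^sub>1 \<circ> \<U>\<^sub>1\<close>.\<close>

primrec layered :: "(nat \<Rightarrow> complex^'n^'n \<Rightarrow> complex^'n^'n) \<Rightarrow> (nat \<Rightarrow> complex^'n^'n) \<Rightarrow> nat \<Rightarrow>
    complex^'n^'n \<Rightarrow> complex^'n^'n" where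
  "layered \<E> U 0 = conjugation (U 1)"
| "layered \<E> U (Suc l) = conjugation (U (l + 2)) \<circ> \<E> (l + 1) \<circ> layered \<E> U l"

section \<open>Well-definedness\<close>

lemma hs_inner_sum: "hs_inner A B = (\<Sum>i\<in>UNIV. \<Sum>j\<in>UNIV. cnj (A $ i $ j) * B $ i $ j)"
  unfolding hs_inner_def trace_def matrix_matrix_mult_def dagger_def cconj_def transpose_def
  by (simp, subst sum.swap, simp)

lemma hs_inner_real: "Re (hs_inner A B) = inner A B"
  by (simp add: hs_inner_sum inner_vec_def inner_complex_def)

lemma hs_inner_herm: "dagger A = A \<Longrightarrow> hs_inner A B = trace (A ** B)"
  by (simp add: hs_inner_def)

lemma hs_inner_cnj: "cnj (hs_inner A B) = hs_inner B A"
  by (simp add: hs_inner_sum mult.commute)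

lemma hs_inner_add_right: "hs_inner A (B + C) = hs_inner A B + hs_inner A C"
  by (simp add: hs_inner_sum algebra_simps sum.distrib)

lemma hs_inner_scale_right: "hs_inner A (cscale c B) = c * hs_inner A B"
  by (simp add: hs_inner_sum cscale_def sum_distrib_left mult_ac)

lemma hs_inner_herm_herm:
  assumes "dagger A = A" "dagger B = B"
  shows "hs_inner A B = of_real (inner A B)"
proof -
  have "cnj (hs_inner A B) = hs_inner B A"
    by (rule hs_inner_cnj)
  also have "\<dots> = hs_inner A B"
    using assms by (simp add: hs_inner_herm trace_mul_sym[of B A])
  finally have "Im (hs_inner A B) = 0"
    by (simp add: complex_eq_iff)
  then show ?thesis
    by (simp add: complex_eq_iff hs_inner_real)
qed

lemma hs_inner_sum_right:
  "hs_inner x (\<Sum>y\<in>T. cscale (f y) y) = (\<Sum>y\<in>T. f y * hs_inner x y)"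
  by (induction T rule: infinite_finite_induct)
    (simp_all add: hs_inner_add_right hs_inner_scale_right, simp_all add: hs_inner_sum)

lemma ex_hermitian_onb:
  fixes V :: "(complex^'n^'n) set"
  assumes V: "cmat.subspace V" and dag: "\<And>A. A \<in> V \<Longrightarrow> dagger A \<in> V"
  shows "\<exists>S. hermitian_onb V S"
proof -
  define W where "W = {A \<in> V. dagger A = A}"
  have scR: "r *\<^sub>R A = cscale (of_real r) A" for r and A :: "complex^'n^'n"
    unfolding cscale_def by (simp add: vec_eq_iff) (simp add: scaleR_conv_of_real)
  have dadd: "dagger (A + B) = dagger A + dagger B" for A B :: "complex^'n^'n"
    by (simp add: dagger_def cconj_def transpose_def vec_eq_iff)
  have dsc: "dagger (cscale c A) = cscale (cnj c) (dagger A)" for c and A :: "complex^'n^'n"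
    by (simp add: dagger_def cconj_def transpose_def vec_eq_iff cscale_def)
  have d0: "dagger (0 :: complex^'n^'n) = 0"
    by (simp add: dagger_def cconj_def transpose_def vec_eq_iff)
  have ddag: "dagger (dagger A) = A" for A :: "complex^'n^'n"
    by (simp add: dagger_def cconj_def transpose_def vec_eq_iff)
  have W: "subspace W"
    unfolding subspace_def W_def
    using V dadd dsc d0 by (auto simp: scR cmat.subspace_def)
  obtain S where S: "S \<subseteq> W" "pairwise orthogonal S" "\<And>x. x \<in> S \<Longrightarrow> norm x = 1"
      "independent S" "card S = dim W" "span S = W"
    using orthonormal_basis_subspace[OF W] by metis
  have herm: "B \<in> S \<Longrightarrow> dagger B = B" for B using S(1) by (auto simp: W_def)
  have on: "hs_inner B C = (if B = C then 1 else 0)" if "B \<in> S" "C \<in> S" for B C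
    using that S(2,3) herm hs_inner_herm_herm[of B C]
    by (auto simp: pairwise_def orthogonal_def norm_eq_1)
  have fin: "finite S" using S(4) independent_imp_finite by blast
  have SV: "S \<subseteq> V" using S(1) by (auto simp: W_def)
  have ind: "cmat.independent S"
  proof (rule cmat.independent_if_scalars_zero[OF fin])
    fix f :: "complex^'n^'n \<Rightarrow> complex" and x
    assume eq: "(\<Sum>x\<in>S. cscale (f x) x) = 0" and x: "x \<in> S"
    have "0 = hs_inner x (0 :: complex^'n^'n)"
      by (simp add: hs_inner_sum)
    also have "\<dots> = (\<Sum>y\<in>S. f y * hs_inner x y)"
      unfolding eq[symmetric] by (rule hs_inner_sum_right)
    also have "\<dots> = (\<Sum>y\<in>S. if x = y then f y else 0)"
      by (rule sum.cong) (use x on in auto)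
    also have "\<dots> = f x" using fin x by simp
    finally show "f x = 0" by simp
  qed
  have WS: "W \<subseteq> cmat.span S"
  proof
    fix A assume "A \<in> W"
    then have "A \<in> span S" using S by simp
    then show "A \<in> cmat.span S"
      by (induction rule: span_induct_alt)
        (auto simp: scR intro: cmat.span_add cmat.span_scale cmat.span_base cmat.span_zero)
  qed
  have "V \<subseteq> cmat.span S"
  proof
    fix A assume A: "A \<in> V"
    let ?H = "cscale (1/2) (A + dagger A)" and ?K = "cscale (- \<i>/2) (A - dagger A)"
    have Vm: "A - dagger A \<in> V" "A + dagger A \<in> V" 
      using V A dag by (auto intro: cmat.subspace_diff cmat.subspace_add)
    have dm: "dagger (A - dagger A) = dagger A - A"
      by (simp add: dagger_def cconj_def transpose_def vec_eq_iff)
    have "?H \<in> V" "?K \<in> V"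
      using Vm V by (blast intro: cmat.subspace_scale)+
    moreover have "dagger ?H = ?H"
      by (simp add: dsc dadd ddag add.commute)
    moreover have "dagger ?K = ?K"
      unfolding dsc dm by (simp add: cscale_def vec_eq_iff algebra_simps)
    ultimately have "?H \<in> W" "?K \<in> W"
      by (auto simp: W_def)
    then have "?H \<in> cmat.span S" "?K \<in> cmat.span S"
      using WS by blast+
    then have "?H + cscale \<i> ?K \<in> cmat.span S"
      by (intro cmat.span_add cmat.span_scale[of ?K])
    moreover have "?H + cscale \<i> ?K = A"
      by (simp add: cscale_def vec_eq_iff algebra_simps)
    ultimately show "A \<in> cmat.span S"
      by (simp only:)
  qed
  then have "cmat.span S = V"
    using SV V by (meson cmat.span_minimal subset_antisym)
  then show ?thesis
    using ind herm on unfolding hermitian_onb_def by blast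
qed

lemma hermitian_onb_subset: "hermitian_onb V S \<Longrightarrow> S \<subseteq> V"
  by (auto simp: hermitian_onb_def cmat.span_base)

lemma hermitian_onb_finite:
  fixes V :: "(complex^'n^'n) set"
  assumes "hermitian_onb V S"
  shows "finite S"
proof -
  have on: "hs_inner B C = (if B = C then 1 else 0)" if "B \<in> S" "C \<in> S" for B C
    using assms that by (simp add: hermitian_onb_def)
  have "pairwise orthogonal S"
    by (auto simp: pairwise_def orthogonal_def on simp flip: hs_inner_real)
  moreover have "hs_inner (0 :: complex^'n^'n) 0 = 0"
    by (simp add: hs_inner_sum)
  then have "0 \<notin> S"
    using on[of 0 0] by auto
  ultimately show ?thesis
    using pairwise_orthogonal_independent independent_imp_finite by blast
qed

lemma hermitian_onb_expand:
  assumes S: "hermitian_onb V S" and A: "A \<in> V"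
  shows "A = (\<Sum>B\<in>S. cscale (hs_inner B A) B)"
proof -
  have fin: "finite S" by (rule hermitian_onb_finite[OF S])
  have "A \<in> cmat.span S"
    using S A by (simp add: hermitian_onb_def)
  then obtain f where f: "A = (\<Sum>B\<in>S. cscale (f B) B)"
    unfolding cmat.span_finite[OF fin] by blast
  have "hs_inner B A = f B" if B: "B \<in> S" for B
  proof -
    have "hs_inner B A = (\<Sum>C\<in>S. f C * hs_inner B C)"
      unfolding f by (rule hs_inner_sum_right)
    also have "\<dots> = (\<Sum>C\<in>S. if B = C then f C else 0)"
      by (rule sum.cong) (use S B in \<open>auto simp: hermitian_onb_def\<close>)
    finally show ?thesis using fin B by simp
  qed
  then show ?thesis using f by simp
qed

lemma trace_sum_scale:
  fixes A :: "complex^'n^'n"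
  shows "trace ((\<Sum>B\<in>S. cscale (f B) B) ** A) = (\<Sum>B\<in>S. f B * trace (B ** A))"
proof (induction S rule: infinite_finite_induct)
  case (insert x F)
  have "trace (cscale c B ** A) = c * trace (B ** A)" for c and B :: "complex^'n^'n"
    by (simp add: trace_def matrix_matrix_mult_def cscale_def sum_distrib_left mult_ac)
  moreover have "trace ((B + C) ** A) = trace (B ** A) + trace (C ** A)"
    for B C :: "complex^'n^'n"
    by (simp add: trace_def matrix_matrix_mult_def sum.distrib algebra_simps)
  ultimately show ?case
    using insert by simp
qed (simp_all add: trace_def matrix_matrix_mult_def)

lemma hermitian_onb_sum_indep:
  fixes A :: "complex^'n^'n"
  assumes S: "hermitian_onb V S" and T: "hermitian_onb V T"
  shows "(\<Sum>B\<in>S. (trace (B ** A))\<^sup>2) = (\<Sum>B\<in>T. (trace (B ** A))\<^sup>2)"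
proof -
  let ?t = "\<lambda>B. trace (B ** A)"
  have sym: "hs_inner C B = hs_inner B C" if "B \<in> S" "C \<in> T" for B C
    using that S T trace_mul_sym[of B C] by (auto simp: hermitian_onb_def hs_inner_herm)
  have exp: "?t B = (\<Sum>C\<in>T. hs_inner C B * ?t C)" if "B \<in> S" for B
  proof -
    have "B \<in> V" using hermitian_onb_subset[OF S] that by blast
    from arg_cong[OF hermitian_onb_expand[OF T this], of ?t]
    show ?thesis by (simp only: trace_sum_scale)
  qed
  have exp': "?t C = (\<Sum>B\<in>S. hs_inner B C * ?t B)" if "C \<in> T" for C
  proof -
    have "C \<in> V" using hermitian_onb_subset[OF T] that by blast
    from arg_cong[OF hermitian_onb_expand[OF S this], of ?t]
    show ?thesis by (simp only: trace_sum_scale)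
  qed
  have sq: "(?t B)\<^sup>2 = (\<Sum>C\<in>T. hs_inner C B * ?t C * ?t B)" if "B \<in> S" for B
  proof -
    have "(?t B)\<^sup>2 = (\<Sum>C\<in>T. hs_inner C B * ?t C) * ?t B"
      by (subst exp[OF that, symmetric]) (simp add: power2_eq_square)
    then show ?thesis by (simp only: sum_distrib_right)
  qed
  have sq': "(?t C)\<^sup>2 = (\<Sum>B\<in>S. hs_inner B C * ?t B * ?t C)" if "C \<in> T" for C
  proof -
    have "(?t C)\<^sup>2 = (\<Sum>B\<in>S. hs_inner B C * ?t B) * ?t C"
      by (subst exp'[OF that, symmetric]) (simp add: power2_eq_square)
    then show ?thesis by (simp only: sum_distrib_right)
  qed
  have "(\<Sum>B\<in>S. (?t B)\<^sup>2) = (\<Sum>B\<in>S. \<Sum>C\<in>T. hs_inner C B * ?t C * ?t B)"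
    by (rule sum.cong[OF refl]) (rule sq)
  also have "\<dots> = (\<Sum>C\<in>T. \<Sum>B\<in>S. hs_inner C B * ?t C * ?t B)"
    by (rule sum.swap)
  also have "\<dots> = (\<Sum>C\<in>T. \<Sum>B\<in>S. hs_inner B C * ?t B * ?t C)"
    by (intro sum.cong refl, subst sym, assumption+) (simp only: mult_ac)
  also have "\<dots> = (\<Sum>C\<in>T. (?t C)\<^sup>2)"
    by (rule sum.cong[OF refl]) (rule sq'[symmetric])
  finally show ?thesis .
qed

lemma dagger_tensor: "dagger (tensor g A) = tensor g (\<lambda>m. dagger (A m))"
  by (simp add: dagger_def cconj_def transpose_def tensor_def vec_eq_iff)

lemma dagger_loc_space:
  assumes "A \<in> loc_space g \<kappa>"
  shows "dagger A \<in> loc_space g \<kappa>"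
  using assms unfolding loc_space_def
proof (induction rule: cmat.span_induct_alt)
  case base
  have "dagger (0 :: 'a qop) = 0"
    by (simp add: dagger_def cconj_def transpose_def vec_eq_iff)
  then show ?case by (simp add: cmat.span_zero)
next
  case (step c x y)
  have eq: "dagger (cscale c x + y) = cscale (cnj c) (dagger x) + dagger y"
    by (simp add: dagger_def cconj_def transpose_def vec_eq_iff cscale_def)
  obtain A where A: "x = tensor g A" "\<forall>m. A m \<in> ops_on (grp g m) \<and>
      (if \<kappa> m then trace (A m) = 0 else A m = id_on (grp g m))"
    using step(1) by auto
  have "dagger B \<in> ops_on X" if "B \<in> ops_on X" for B :: "'a qop" and X
    using that by (auto simp: ops_on_def dagger_def cconj_def transpose_def)
  moreover have "trace (dagger B) = cnj (trace B)" for B :: "'a qop"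
    by (simp add: trace_def dagger_def cconj_def transpose_def)
  moreover have "dagger (id_on X) = id_on X" for X :: "'a set"
    by (auto simp: id_on_def dagger_def cconj_def transpose_def vec_eq_iff)
  ultimately have "\<forall>m. dagger (A m) \<in> ops_on (grp g m) \<and>
      (if \<kappa> m then trace (dagger (A m)) = 0 else dagger (A m) = id_on (grp g m))"
    using A(2) by simp
  then show ?case
    unfolding eq unfolding A(1) dagger_tensor
    by (intro cmat.span_add cmat.span_scale step(2)) (blast intro: cmat.span_base)
qed

lemma hermitian_onb_herm_basis: "hermitian_onb (loc_space g \<kappa>) (herm_basis g \<kappa>)"
  unfolding herm_basis_def
  by (rule someI_ex, rule ex_hermitian_onb[OF _ dagger_loc_space])
    (simp_all add: loc_space_def)

theorem locality_vector_basis: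
  assumes "hermitian_onb (loc_space g \<kappa>) S"
  shows "locality_vector g A $ \<kappa> = (\<Sum>B\<in>S. (trace (B ** A))\<^sup>2)"
  by (simp add: locality_vector_def hermitian_onb_sum_indep[OF hermitian_onb_herm_basis assms])

lemma hs_adjoint_unique:
  assumes "\<And>A B. hs_inner (F A) B = hs_inner A (\<Lambda> B)"
  shows "hs_adjoint \<Lambda> = F"
  unfolding hs_adjoint_def
proof (rule the_equality)
  show "\<forall>A B. hs_inner (F A) B = hs_inner A (\<Lambda> B)" using assms by blast
next
  fix G assume G: "\<forall>A B. hs_inner (G A) B = hs_inner A (\<Lambda> B)"
  show "G = F"
  proof
    fix A
    have "inner (G A) B = inner (F A) B" for B
      using G assms by (metis hs_inner_real)
    then show "G A = F A" by (metis vector_eq_rdot)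
  qed
qed

theorem hs_adjoint_eq:
  fixes \<Lambda> :: "complex^'n^'n \<Rightarrow> complex^'n^'n"
  assumes lin: "linear_map \<Lambda>"
  shows "hs_inner (hs_adjoint \<Lambda> A) B = hs_inner A (\<Lambda> B)"
proof -
  interpret L: Vector_Spaces.linear cscale cscale \<Lambda> using lin by (simp add: linear_map_def)
  let ?E = "\<lambda>k l. (\<chi> i j. if i = k \<and> j = l then 1 else 0) :: complex^'n^'n"
  define F where "F A = (\<chi> k l. cnj (hs_inner A (\<Lambda> (?E k l))))" for A
  have dec: "B = (\<Sum>k\<in>UNIV. \<Sum>l\<in>UNIV. cscale (B $ k $ l) (?E k l))" for B
  proof -
    have *: "B $ k $ l * (if i = k \<and> j = l then 1 else 0) =
        (if k = i then if l = j then B $ i $ j else 0 else 0)" for k l i j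
      by auto
    have **: "(\<Sum>l\<in>UNIV. if k = i then if l = j then B $ i $ j else 0 else 0) =
        (if k = i then B $ i $ j else 0)" for k i j
      by (cases "k = i") simp_all
    show ?thesis by (simp add: vec_eq_iff cscale_def * ** )
  qed
  have hs_sum: "hs_inner X (sum h I) = (\<Sum>i\<in>I. hs_inner X (h i))"
    for X :: "complex^'n^'n" and h :: "'n \<Rightarrow> _" and I
    by (induction I rule: infinite_finite_induct) (simp_all add: hs_inner_add_right,
        simp_all add: hs_inner_sum)
  have F: "hs_inner (F A) B = hs_inner A (\<Lambda> B)" for A B
  proof -
    have "hs_inner A (\<Lambda> B) =
        hs_inner A (\<Lambda> (\<Sum>k\<in>UNIV. \<Sum>l\<in>UNIV. cscale (B $ k $ l) (?E k l)))"
      using dec[of B] by simp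
    also have "\<dots> = (\<Sum>k\<in>UNIV. \<Sum>l\<in>UNIV. B $ k $ l * hs_inner A (\<Lambda> (?E k l)))"
      by (simp only: L.sum L.scale hs_sum hs_inner_scale_right)
    also have "\<dots> = hs_inner (F A) B"
      unfolding hs_inner_sum[of "F A" B] by (simp add: F_def mult.commute)
    finally show ?thesis by simp
  qed
  then have "hs_adjoint \<Lambda> = F" by (rule hs_adjoint_unique)
  then show ?thesis using F by simp
qed

theorem ltm_basis:
  fixes \<Lambda> :: "'q::finite qop \<Rightarrow> 'q qop"
  assumes lin: "linear_map \<Lambda>" and S: "hermitian_onb (loc_space g \<nu>) S"
  shows "ltm g \<Lambda> $ \<kappa> $ \<nu> =
    1 / of_nat (loc_dim g \<nu>) * (\<Sum>B\<in>S. locality_vector g (\<Lambda> B) $ \<kappa>)"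
proof -
  have tr: "trace (C ** \<Lambda> B) = trace (B ** dagger (hs_adjoint \<Lambda> C))"
    if "C \<in> herm_basis g \<kappa>" for B C
  proof -
    have "trace (C ** \<Lambda> B) = hs_inner C (\<Lambda> B)"
      using that hermitian_onb_herm_basis[of g \<kappa>] by (simp add: hermitian_onb_def hs_inner_herm)
    also have "\<dots> = trace (dagger (hs_adjoint \<Lambda> C) ** B)"
      using hs_adjoint_eq[OF lin, of C B] by (simp add: hs_inner_def)
    finally show ?thesis
      by (simp add: trace_mul_sym[of B])
  qed
  have sw: "(\<Sum>B\<in>X. locality_vector g (\<Lambda> B) $ \<kappa>) =
      (\<Sum>C\<in>herm_basis g \<kappa>. \<Sum>B\<in>X. (trace (B ** dagger (hs_adjoint \<Lambda> C)))\<^sup>2)" for X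
    unfolding locality_vector_def by (simp add: tr) (rule sum.swap)
  show ?thesis
    unfolding ltm_def by (simp add: sw hermitian_onb_sum_indep[OF hermitian_onb_herm_basis S])
qed

end

theory Submission
  imports Defs
begin

text \<open>For an orthonormal Hermitian basis \<open>B\<^sub>j\<close> of \<open>\<B>\<^sub>\<kappa>\<close> put \<open>\<Omega>\<^sub>\<kappa> = \<Sum>\<^sub>j B\<^sub>j \<otimes> B\<^sub>j\<close>. This is the product
  over the tensor factors of \<open>\<one>/D\<close> (where \<open>\<kappa>\<^sub>m = 0\<close>) and \<open>SWAP - \<one>/D\<close> (where \<open>\<kappa>\<^sub>m = 1\<close>),
  \<open>D\<close> being the dimension of the factor. The operators commuting with all \<open>V \<otimes> V\<close>, \<open>V\<close> unitary, are
  spanned by \<open>\<one>\<close> and \<open>SWAP\<close>, so one layer of independent 2-designs acts on operators on two copies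
  of the system as \<open>X \<mapsto> \<Sum>\<^sub>\<kappa> Tr[\<Omega>\<^sub>\<kappa> X] / d\<^sub>\<kappa> \<Omega>\<^sub>\<kappa>\<close>. Since \<open>Tr[\<Omega>\<^sub>\<kappa> (A \<otimes> A)] = (\<ell>\<^sub>A)\<^sub>\<kappa>\<close>, averaging over
  the last layer replaces \<open>H \<otimes> H\<close> by \<open>\<Sum>\<^sub>\<kappa> (\<ell>\<^sub>H)\<^sub>\<kappa> / d\<^sub>\<kappa> \<Sum>\<^sub>j B\<^sub>j \<otimes> B\<^sub>j\<close>. A channel preserves Hermiticity, hence
  can be moved onto the \<open>B\<^sub>j\<close> as its adjoint, and the claim follows by induction on the number of
  layers, with \<open>H\<close> generalised.\<close>

section \<open>Kernels of the locality subspaces\<close>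

text \<open>A bit string is the same thing as the family of its restrictions
  \<open>x \<inter> grp g m\<close>, with union as the inverse; expanding the product of sums then
  yields the left-hand side.\<close>

lemma sum_prod_grp:
  fixes f :: "'m::finite \<Rightarrow> 'q::finite set \<Rightarrow> 'a::comm_semiring_1"
  shows "(\<Sum>x\<in>UNIV. \<Prod>m\<in>UNIV. f m (x \<inter> grp g m)) = (\<Prod>m\<in>UNIV. \<Sum>x\<in>Pow (grp g m). f m x)"
proof -
  have "(\<Prod>m\<in>UNIV. \<Sum>x\<in>Pow (grp g m). f m x) =
      (\<Sum>p\<in>PiE UNIV (\<lambda>m. Pow (grp g m)). \<Prod>m\<in>UNIV. f m (p m))"
    by (rule prod_sum_PiE) auto
  also have "\<dots> = (\<Sum>x\<in>UNIV. \<Prod>m\<in>UNIV. f m (x \<inter> grp g m))"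
  proof (rule sum.reindex_bij_witness[where i = "\<lambda>x m. x \<inter> grp g m" and j = "\<lambda>p. \<Union>m. p m"])
    fix p assume p: "p \<in> PiE UNIV (\<lambda>m. Pow (grp g m))"
    show *: "(\<lambda>m. (\<Union>m. p m) \<inter> grp g m) = p"
      using p by (fastforce simp: grp_def PiE_def Pi_def fun_eq_iff)
    show "(\<Prod>m\<in>UNIV. f m ((\<Union>m. p m) \<inter> grp g m)) = (\<Prod>m\<in>UNIV. f m (p m))"
      using fun_cong[OF *] by simp
  qed (auto simp: grp_def)
  finally show ?thesis by simp
qed

lemma sum_sum_prod_grp:
  fixes f :: "'m::finite \<Rightarrow> 'q::finite set \<Rightarrow> 'q set \<Rightarrow> 'a::comm_semiring_1"
  shows "(\<Sum>x\<in>UNIV. \<Sum>y\<in>UNIV. \<Prod>m\<in>UNIV. f m (x \<inter> grp g m) (y \<inter> grp g m)) =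
    (\<Prod>m\<in>UNIV. \<Sum>x\<in>Pow (grp g m). \<Sum>y\<in>Pow (grp g m). f m x y)"
proof -
  have "(\<Sum>x\<in>UNIV. \<Sum>y\<in>UNIV. \<Prod>m\<in>UNIV. f m (x \<inter> grp g m) (y \<inter> grp g m)) =
      (\<Sum>x\<in>UNIV. \<Prod>m\<in>UNIV. \<Sum>y\<in>Pow (grp g m). f m (x \<inter> grp g m) y)"
    by (intro sum.cong refl sum_prod_grp)
  also have "\<dots> = (\<Prod>m\<in>UNIV. \<Sum>x\<in>Pow (grp g m). \<Sum>y\<in>Pow (grp g m). f m x y)"
    by (rule sum_prod_grp)
  finally show ?thesis .
qed

text \<open>In coordinates this is the partial trace identity
  \<open>Tr_2[SWAP (1 \<otimes> A)] = A\<close>: the \<open>of_bool\<close> factor is the entry of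
  SWAP in row (c, d) and column (a, b).\<close>

lemma sum_of_bool_conj_times:
  fixes f :: "'a \<Rightarrow> 'a \<Rightarrow> complex"
  assumes "finite T" "a \<in> T" "c \<in> T"
  shows "(\<Sum>b\<in>T. \<Sum>d\<in>T. of_bool (c = b \<and> d = a) * f b d) = f c a"
proof -
  have "(\<Sum>b\<in>T. \<Sum>d\<in>T. of_bool (c = b \<and> d = a) * f b d) =
      (\<Sum>b\<in>T. if b = c then f b a else 0)"
  proof (rule sum.cong[OF refl])
    fix b
    show "(\<Sum>d\<in>T. of_bool (c = b \<and> d = a) * f b d) = (if b = c then f b a else 0)"
      using assms by (cases "b = c") (auto simp: of_bool_def if_distrib[of "\<lambda>t. t * _"] cong: if_cong)
  qed
  then show ?thesis using assms by simp
qed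

text \<open>The entry of \<open>\<one>/D\<close> (\<open>k\<close> false) or \<open>SWAP - \<one>/D\<close> (\<open>k\<close> true) in row \<open>(c, d)\<close> and column
  \<open>(a, b)\<close>; meaningful only when all four indices are subsets of \<open>S\<close>.\<close>

definition factor_kernel :: "'q::finite set \<Rightarrow> bool \<Rightarrow> 'q set \<Rightarrow> 'q set \<Rightarrow> 'q set \<Rightarrow> 'q set \<Rightarrow> complex"
  where "factor_kernel S k c d a b =
    (if k then of_bool (c = b \<and> d = a) - of_bool (c = a \<and> d = b) / 2 ^ card S
     else of_bool (c = a \<and> d = b) / 2 ^ card S)"

text \<open>The entry of \<open>\<Omega>\<^sub>\<kappa>\<close> in row (c, d) and column (a,
  b).\<close>

definition loc_kernel :: "('q::finite \<Rightarrow> 'm::finite) \<Rightarrow> ('m \<Rightarrow> bool) \<Rightarrow>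
    'q set \<Rightarrow> 'q set \<Rightarrow> 'q set \<Rightarrow> 'q set \<Rightarrow> complex"
  where "loc_kernel g \<kappa> c d a b = (\<Prod>m\<in>UNIV. factor_kernel (grp g m) (\<kappa> m)
    (c \<inter> grp g m) (d \<inter> grp g m) (a \<inter> grp g m) (b \<inter> grp g m))"

text \<open>With \<open>D = 2 ^ card S\<close>, this is the dimension of the traceless operators on
  the factor, or of the multiples of its unit. It is complex valued because it divides complex
  moments.\<close>

definition factor_dim :: "'q::finite set \<Rightarrow> bool \<Rightarrow> complex"
  where "factor_dim S k = (if k then 4 ^ card S - 1 else 1)"

lemma sum_of_bool_diag:
  "finite T \<Longrightarrow> (\<Sum>b\<in>T. \<Sum>d\<in>T. of_bool (d = b) * f b d) = (\<Sum>b\<in>T. (f b b :: complex))"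
  by (simp add: of_bool_def if_distrib[of "\<lambda>t. t * _"] cong: if_cong)

lemma ops_on_outside: "A \<in> ops_on S \<Longrightarrow> \<not> x \<subseteq> S \<or> \<not> y \<subseteq> S \<Longrightarrow> A $ x $ y = 0"
  by (auto simp: ops_on_def)

lemma trace_ops_on: "A \<in> ops_on S \<Longrightarrow> trace A = (\<Sum>x\<in>Pow S. A $ x $ x)"
  unfolding trace_def by (rule sum.mono_neutral_right) (auto simp: ops_on_outside)

text \<open>The sum is a partial trace over the second copy. SWAP contributes A itself and
  \<open>1/D\<close> contributes the unit times \<open>trace A / D\<close>, which is 0 for traceless
  A and the unit itself if A is the unit.\<close>

lemma factor_kernel_fixes:
  assumes A: "A \<in> ops_on S" "if k then trace A = 0 else A = id_on S"
    and "c \<subseteq> S" "a \<subseteq> S"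
  shows "(\<Sum>b\<in>Pow S. \<Sum>d\<in>Pow S. factor_kernel S k c d a b * A $ b $ d) = A $ c $ a"
proof -
  have eq: "of_bool (c = a \<and> d = b) / 2 ^ card S * t =
    of_bool (d = b) * (of_bool (c = a) / 2 ^ card S * t)" for d b and t :: complex
    by auto
  have 1: "(\<Sum>b\<in>Pow S. \<Sum>d\<in>Pow S. of_bool (c = a \<and> d = b) / 2 ^ card S * A $ b $ d) =
      of_bool (c = a) / 2 ^ card S * trace A"
    unfolding eq by (subst sum_of_bool_diag) (auto simp: trace_ops_on[OF A(1)] sum_distrib_left)
  have tr: "trace (id_on S) = 2 ^ card S"
    by (subst trace_ops_on[of _ S]) (auto simp: id_on_def ops_on_def card_Pow)
  show ?thesis
  proof (cases k)
    case True
    have "(\<Sum>b\<in>Pow S. \<Sum>d\<in>Pow S. of_bool (c = b \<and> d = a) * A $ b $ d) = A $ c $ a"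
      using assms by (intro sum_of_bool_conj_times) auto
    then show ?thesis
      using True A 1 by (simp add: factor_kernel_def left_diff_distrib sum_subtractf)
  next
    case False
    then have "(\<Sum>b\<in>Pow S. \<Sum>d\<in>Pow S. factor_kernel S k c d a b * A $ b $ d) =
      of_bool (c = a) / 2 ^ card S * trace A"
      by (simp add: factor_kernel_def 1[unfolded times_divide_eq_left])
    moreover have "A $ c $ a = of_bool (c = a)"
      using False A(2) assms(3) by (simp add: id_on_def)
    moreover have "trace A = 2 ^ card S"
      using False A(2) tr by simp
    ultimately show ?thesis by simp
  qed
qed

lemma factor_kernel_swap: "factor_kernel S k c d a b = factor_kernel S k d c b a"
  by (simp add: factor_kernel_def conj_commute)

lemma loc_kernel_swap: "loc_kernel g \<kappa> c d a b = loc_kernel g \<kappa> d c b a"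
  unfolding loc_kernel_def by (rule prod.cong[OF refl factor_kernel_swap])

text \<open>Linearity reduces the claim to tensor products, for which the double sum factorises over
  the groups of qubits.\<close>

lemma loc_kernel_fixes:
  fixes g :: "'q::finite \<Rightarrow> 'm::finite"
  assumes "A \<in> loc_space g \<kappa>"
  shows "(\<Sum>b\<in>UNIV. \<Sum>d\<in>UNIV. loc_kernel g \<kappa> c d a b * A $ b $ d) = A $ c $ a"
  using assms unfolding loc_space_def
proof (induction rule: cmat.span_induct_alt)
  case base
  then show ?case by simp
next
  case (step r x y)
  obtain A where x: "x = tensor g A" and A: "\<And>m. A m \<in> ops_on (grp g m)"
      "\<And>m. if \<kappa> m then trace (A m) = 0 else A m = id_on (grp g m)"
    using step(1) by auto
  have "(\<Sum>b\<in>UNIV. \<Sum>d\<in>UNIV. loc_kernel g \<kappa> c d a b * x $ b $ d) =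
    (\<Sum>b\<in>UNIV. \<Sum>d\<in>UNIV. \<Prod>m\<in>UNIV. factor_kernel (grp g m) (\<kappa> m)
      (c \<inter> grp g m) (d \<inter> grp g m) (a \<inter> grp g m) (b \<inter> grp g m) *
      A m $ (b \<inter> grp g m) $ (d \<inter> grp g m))"
    by (simp add: x loc_kernel_def tensor_def prod.distrib)
  also have "\<dots> = (\<Prod>m\<in>UNIV. \<Sum>b\<in>Pow (grp g m). \<Sum>d\<in>Pow (grp g m). factor_kernel (grp g m) (\<kappa> m)
      (c \<inter> grp g m) d (a \<inter> grp g m) b * A m $ b $ d)"
    by (rule sum_sum_prod_grp)
  also have "\<dots> = (\<Prod>m\<in>UNIV. A m $ (c \<inter> grp g m) $ (a \<inter> grp g m))"
    by (intro prod.cong refl factor_kernel_fixes) (use A in auto)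
  also have "\<dots> = x $ c $ a" by (simp add: x tensor_def)
  finally show ?case
    using step(2) by (simp add: cscale_def algebra_simps sum.distrib flip: sum_distrib_left)
qed

lemma loc_kernel_in_loc_space:
  fixes g :: "'q::finite \<Rightarrow> 'm::finite"
  shows "(\<chi> c a. loc_kernel g \<kappa> c d a b) \<in> loc_space g \<kappa>"
proof -
  \<comment> \<open>On a factor with \<open>\<kappa>\<close> false the kernel is the unit times a
    scalar depending only on d and b. Collecting these scalars in u leaves exactly
    \<open>id_on\<close> there, hence a generator of the space.\<close>
  define u where "u m = (if \<kappa> m then 1 else of_bool (d \<inter> grp g m = b \<inter> grp g m) / 2 ^ card (grp g m) :: complex)" for m
  define A where "A m = (\<chi> c a. if c \<subseteq> grp g m \<and> a \<subseteq> grp g m then (if \<kappa> m then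
    factor_kernel (grp g m) True c (d \<inter> grp g m) a (b \<inter> grp g m) else of_bool (c = a)) else 0)" for m
  have ops: "A m \<in> ops_on (grp g m)" for m
    by (auto simp: ops_on_def A_def split: if_splits)
  have id: "A m = id_on (grp g m)" if "\<not> \<kappa> m" for m
    using that by (auto simp: A_def id_on_def vec_eq_iff)
  have tr: "trace (A m) = 0" if "\<kappa> m" for m
  proof -
    let ?S = "grp g m" and ?d = "d \<inter> grp g m" and ?b = "b \<inter> grp g m"
    have "trace (A m) = (\<Sum>c\<in>Pow ?S. factor_kernel ?S True c ?d c ?b)"
      unfolding trace_ops_on[OF ops] by (rule sum.cong) (use that in \<open>auto simp: A_def\<close>)
    \<comment> \<open>SWAP contributes the single term c = ?b and the normalised unit D equal terms;
      both sums equal \<open>of_bool (?d = ?b)\<close>.\<close>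
    also have "\<dots> = (\<Sum>c\<in>Pow ?S. (if c = ?b then of_bool (?d = ?b) else 0)) -
        (\<Sum>c\<in>Pow ?S. of_bool (?d = ?b) / 2 ^ card ?S)"
      unfolding sum_subtractf[symmetric] by (rule sum.cong) (auto simp: factor_kernel_def)
    also have "\<dots> = 0" by (simp add: card_Pow)
    finally show ?thesis .
  qed
  have "tensor g A \<in> loc_space g \<kappa>"
    unfolding loc_space_def by (rule cmat.span_base) (use ops id tr in auto)
  then have "cscale (\<Prod>m\<in>UNIV. u m) (tensor g A) \<in> loc_space g \<kappa>"
    unfolding loc_space_def by (rule cmat.span_scale)
  also have "cscale (\<Prod>m\<in>UNIV. u m) (tensor g A) = (\<chi> c a. loc_kernel g \<kappa> c d a b)"
    unfolding vec_eq_iff cscale_def tensor_def loc_kernel_def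
    by (auto simp flip: prod.distrib intro!: prod.cong simp: u_def A_def factor_kernel_def)
  finally show ?thesis .
qed

text \<open>Both sides are the reproducing kernel of \<open>loc_space g \<kappa>\<close>: \<open>loc_kernel\<close> has its columns in that
  space and acts on it as the identity.\<close>

lemma hermitian_onb_loc_kernel:
  fixes g :: "'q::finite \<Rightarrow> 'm::finite"
  assumes S: "hermitian_onb (loc_space g \<kappa>) S"
  shows "(\<Sum>B\<in>S. B $ c $ a * B $ d $ b) = loc_kernel g \<kappa> c d a b"
proof -
  let ?M = "\<chi> c a. loc_kernel g \<kappa> c d a b"
  \<comment> \<open>As B is Hermitian, its pairing with a column of the kernel is a bilinear trace,
    which the reproducing property collapses to one entry of B. These are the coefficients of the
    column in the basis.\<close>
  have in_prod: "hs_inner B ?M = B $ d $ b" if B: "B \<in> S" for B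
  proof -
    have "hs_inner B ?M = trace (B ** ?M)"
      using S B by (simp add: hermitian_onb_def hs_inner_herm)
    also have "\<dots> = (\<Sum>a\<in>UNIV. \<Sum>c\<in>UNIV. loc_kernel g \<kappa> d c b a * B $ a $ c)"
      unfolding trace_def matrix_matrix_mult_def
      by (simp add: mult.commute loc_kernel_swap[of g \<kappa> _ d])
    also have "\<dots> = B $ d $ b"
      using hermitian_onb_subset[OF S] B by (intro loc_kernel_fixes) auto
    finally show ?thesis .
  qed
  have "?M $ c $ a = (\<Sum>B\<in>S. cscale (hs_inner B ?M) B) $ c $ a"
    by (rule arg_cong[OF hermitian_onb_expand[OF S loc_kernel_in_loc_space], of "\<lambda>A. A $ c $ a"])
  also have "\<dots> = (\<Sum>B\<in>S. B $ c $ a * B $ d $ b)"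
    by (simp add: sum_component cscale_def in_prod mult.commute)
  finally show ?thesis by simp
qed

text \<open>The number of basis elements is the sum of all \<open>Tr[B B]\<close>, that is
  \<open>Tr[SWAP \<Omega>\<^sub>\<kappa>]\<close>. This trace factorises, a factor giving
  \<open>D / D = 1\<close> or \<open>D^2 - 1\<close>.\<close>

lemma of_nat_loc_dim:
  fixes g :: "'q::finite \<Rightarrow> 'm::finite"
  shows "of_nat (loc_dim g \<kappa>) = (\<Prod>m\<in>UNIV. factor_dim (grp g m) (\<kappa> m))"
proof -
  let ?S = "herm_basis g \<kappa>"
  note S = hermitian_onb_herm_basis[of g \<kappa>]
  have tr: "trace (B ** B) = 1" if "B \<in> ?S" for B
    using S that unfolding hermitian_onb_def by (metis hs_inner_herm)
  have "loc_dim g \<kappa> = card ?S"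
    using S unfolding loc_dim_def hermitian_onb_def by (metis cmat.dim_span_eq_card_independent)
  then have "of_nat (loc_dim g \<kappa>) = (\<Sum>B\<in>?S. trace (B ** B))"
    by (simp add: tr)
  also have "\<dots> = (\<Sum>c\<in>UNIV. \<Sum>a\<in>UNIV. \<Sum>B\<in>?S. B $ c $ a * B $ a $ c)"
    unfolding trace_def matrix_matrix_mult_def
    by (simp add: sum.swap[of _ ?S])
  also have "\<dots> = (\<Sum>c\<in>UNIV. \<Sum>a\<in>UNIV. loc_kernel g \<kappa> c a a c)"
    by (simp add: hermitian_onb_loc_kernel[OF S])
  also have "\<dots> = (\<Prod>m\<in>UNIV. \<Sum>c\<in>Pow (grp g m). \<Sum>a\<in>Pow (grp g m).
      factor_kernel (grp g m) (\<kappa> m) c a a c)"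
    unfolding loc_kernel_def by (rule sum_sum_prod_grp)
  also have "\<dots> = (\<Prod>m\<in>UNIV. factor_dim (grp g m) (\<kappa> m))"
  proof (rule prod.cong[OF refl])
    fix m
    let ?T = "grp g m"
    have 1: "(\<Sum>c\<in>Pow ?T. \<Sum>a\<in>Pow ?T. of_bool (c = a \<and> a = c) / 2 ^ card ?T) = (1 :: complex)"
    proof -
      have "of_bool (c = a \<and> a = c) / 2 ^ card ?T = (if c = a then 1 / 2 ^ card ?T else 0 :: complex)"
        for c a :: "'q set"
        by auto
      then show ?thesis by (simp add: card_Pow)
    qed
    have "(4 :: complex) ^ card ?T = 2 ^ card ?T * 2 ^ card ?T"
      by (simp flip: power_mult_distrib)
    then show "(\<Sum>c\<in>Pow ?T. \<Sum>a\<in>Pow ?T. factor_kernel ?T (\<kappa> m) c a a c) = factor_dim ?T (\<kappa> m)"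
      using 1 by (simp add: factor_kernel_def factor_dim_def sum_subtractf card_Pow)
  qed
  finally show ?thesis .
qed

section \<open>The second moments of a unitary 2-design\<close>

text \<open>Boundedness, unlike integrability, survives products, so every polynomial in matrix
  entries and their conjugates stays in this class and is integrable for a probability
  measure.\<close>

definition bounded_rv :: "'w measure \<Rightarrow> ('w \<Rightarrow> complex) \<Rightarrow> bool" where
  "bounded_rv M f \<longleftrightarrow> f \<in> borel_measurable M \<and> (\<exists>C. \<forall>\<omega>\<in>space M. norm (f \<omega>) \<le> C)"

lemma bounded_rv_const [intro]: "bounded_rv M (\<lambda>_. c)"
  by (auto simp: bounded_rv_def)

lemma bounded_rv_cnj [intro]: "bounded_rv M f \<Longrightarrow> bounded_rv M (\<lambda>\<omega>. cnj (f \<omega>))"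
  unfolding bounded_rv_def using borel_measurable_continuous_on[OF continuous_on_cnj[OF continuous_on_id]]
  by auto

lemma bounded_rv_add [intro]:
  assumes "bounded_rv M f" "bounded_rv M h"
  shows "bounded_rv M (\<lambda>\<omega>. f \<omega> + h \<omega>)"
proof -
  obtain C D where "\<And>\<omega>. \<omega> \<in> space M \<Longrightarrow> norm (f \<omega>) \<le> C" "\<And>\<omega>. \<omega> \<in> space M \<Longrightarrow> norm (h \<omega>) \<le> D"
    using assms by (auto simp: bounded_rv_def)
  then have "\<forall>\<omega>\<in>space M. norm (f \<omega> + h \<omega>) \<le> C + D"
    by (meson norm_add_rule_thm)
  then show ?thesis using assms by (auto simp: bounded_rv_def)
qed

lemma bounded_rv_mult [intro]:
  assumes "bounded_rv M f" "bounded_rv M h"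
  shows "bounded_rv M (\<lambda>\<omega>. f \<omega> * h \<omega>)"
proof -
  obtain C D where C: "\<And>\<omega>. \<omega> \<in> space M \<Longrightarrow> norm (f \<omega>) \<le> C"
    and D: "\<And>\<omega>. \<omega> \<in> space M \<Longrightarrow> norm (h \<omega>) \<le> D"
    using assms by (auto simp: bounded_rv_def)
  have "norm (f \<omega> * h \<omega>) \<le> C * D" if "\<omega> \<in> space M" for \<omega>
    unfolding norm_mult using C[OF that] D[OF that]
    by (intro mult_mono) (auto intro: order_trans[OF norm_ge_zero])
  then show ?thesis using assms by (auto simp: bounded_rv_def)
qed

lemma bounded_rv_sum [intro]:
  "(\<And>i. i \<in> I \<Longrightarrow> bounded_rv M (f i)) \<Longrightarrow> bounded_rv M (\<lambda>\<omega>. \<Sum>i\<in>I. f i \<omega>)"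
  by (induction I rule: infinite_finite_induct) auto

lemma bounded_rv_prod [intro]:
  "(\<And>i. i \<in> I \<Longrightarrow> bounded_rv M (f i)) \<Longrightarrow> bounded_rv M (\<lambda>\<omega>. \<Prod>i\<in>I. f i \<omega>)"
  by (induction I rule: infinite_finite_induct) auto

lemma bounded_rv_integrable:
  assumes "finite_measure M" "bounded_rv M f"
  shows "integrable M f"
proof -
  obtain C where "\<And>\<omega>. \<omega> \<in> space M \<Longrightarrow> norm (f \<omega>) \<le> C"
    using assms by (auto simp: bounded_rv_def)
  then show ?thesis
    using assms(2) by (intro finite_measure.integrable_const_bound[OF assms(1)] AE_I2)
      (auto simp: bounded_rv_def)
qed

text \<open>A column of U has squared norm 1 or 0, according to whether its index is a subset of S,
  and this bounds each of its entries.\<close>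

lemma unitary_group_norm_le:
  assumes U: "U \<in> unitary_group S"
  shows "norm (U $ i $ j) \<le> 1"
proof -
  have "(dagger U ** U) $ j $ j = (\<Sum>k\<in>UNIV. complex_of_real ((norm (U $ k $ j))\<^sup>2))"
    unfolding complex_norm_square
    by (simp add: matrix_matrix_mult_def dagger_def cconj_def transpose_def mult.commute)
  moreover have "(dagger U ** U) $ j $ j = complex_of_real (of_bool (j \<subseteq> S))"
    using U by (simp add: unitary_group_def id_on_def)
  ultimately have "(\<Sum>k\<in>UNIV. (norm (U $ k $ j))\<^sup>2) = of_bool (j \<subseteq> S)"
    by (simp only: of_real_sum[symmetric] of_real_eq_iff)
  moreover have "(norm (U $ i $ j))\<^sup>2 \<le> (\<Sum>k\<in>UNIV. (norm (U $ k $ j))\<^sup>2)"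
    by (rule member_le_sum) auto
  ultimately have "(norm (U $ i $ j))\<^sup>2 \<le> 1" by (auto simp: of_bool_def split: if_splits)
  then show ?thesis by (simp add: power_le_one_iff abs_le_square_iff power2_le_iff_abs_le)
qed

section \<open>Entrywise measurability and integration\<close>

lemma measurable_entry:
  fixes F :: "'w \<Rightarrow> complex^'n^'m"
  assumes "F \<in> borel_measurable M"
  shows "(\<lambda>\<omega>. F \<omega> $ i $ j) \<in> borel_measurable M"
  by (rule borel_measurable_continuous_on[OF _ assms]) (intro continuous_intros)

text \<open>A uniform bound on the entries makes the matrix-valued function Bochner integrable, so
  that the bounded linear coordinate map commutes with the integral.\<close>

lemma integral_entry:
  fixes F :: "'w \<Rightarrow> complex^'n^'m"
  assumes "finite_measure M" "F \<in> borel_measurable M"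
    and bdd: "\<And>i j \<omega>. \<omega> \<in> space M \<Longrightarrow> norm (F \<omega> $ i $ j) \<le> C"
  shows "(\<integral>\<omega>. F \<omega> \<partial>M) $ i $ j = (\<integral>\<omega>. F \<omega> $ i $ j \<partial>M)"
proof -
  have "norm (F \<omega>) \<le> (\<Sum>i\<in>(UNIV :: 'm set). \<Sum>j\<in>(UNIV :: 'n set). C)" if "\<omega> \<in> space M" for \<omega>
  proof -
    have "norm (F \<omega>) \<le> (\<Sum>i\<in>UNIV. norm (F \<omega> $ i))"
      unfolding norm_vec_def[of "F \<omega>"] by (rule L2_set_le_sum) auto
    also have "\<dots> \<le> (\<Sum>i\<in>UNIV. \<Sum>j\<in>UNIV. norm (F \<omega> $ i $ j))"
      by (intro sum_mono) (auto simp: norm_vec_def[of "F \<omega> $ _"] intro: L2_set_le_sum)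
    also have "\<dots> \<le> (\<Sum>i\<in>(UNIV :: 'm set). \<Sum>j\<in>(UNIV :: 'n set). C)"
      by (intro sum_mono bdd that)
    finally show ?thesis .
  qed
  then have int: "integrable M F"
    by (intro finite_measure.integrable_const_bound[OF assms(1)] assms(2) AE_I2)
  have "bounded_linear (\<lambda>A :: complex^'n^'m. A $ i $ j)"
    by (rule bounded_linear_compose[OF bounded_linear_vec_nth bounded_linear_vec_nth])
  from integral_bounded_linear[OF this int] show ?thesis by simp
qed

section \<open>Invariance of Haar integrals\<close>

lemma haar_measure_borel:
  assumes "haar_measure S \<mu>" "\<phi> \<in> borel_measurable borel"
  shows "\<phi> \<in> borel_measurable \<mu>"
proof -
  have "sets \<mu> = sets (restrict_space borel (unitary_group S))"
    using assms by (simp add: haar_measure_def)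
  then show ?thesis
    using measurable_restrict_space1[OF assms(2)] measurable_cong_sets by blast
qed

text \<open>Invariance is given for the image measure on the restricted sigma-algebra; the work is
  to see that left multiplication by V maps the unitary group measurably into itself.\<close>

lemma haar_measure_left_invariant:
  fixes \<phi> :: "'q::finite qop \<Rightarrow> complex"
  assumes \<mu>: "haar_measure S \<mu>" and V: "V \<in> unitary_group S"
    and \<phi>: "\<phi> \<in> borel_measurable borel"
  shows "(\<integral>U. \<phi> (V ** U) \<partial>\<mu>) = (\<integral>U. \<phi> U \<partial>\<mu>)"
proof -
  have sp: "space \<mu> = unitary_group S" and st: "sets \<mu> = sets (restrict_space borel (unitary_group S))"
    using \<mu> by (auto simp: haar_measure_def)
  have dag: "dagger (V ** U) = dagger U ** dagger V" for U
    by (simp add: dagger_def cconj_def transpose_def matrix_matrix_mult_def vec_eq_iff mult.commute)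
  \<comment> \<open>\<open>id_on S\<close> is in general only a projection; it acts as a unit on the
    operators supported on S.\<close>
  have idr: "A ** id_on S = A" if "A \<in> ops_on S" for A
  proof -
    have "(\<Sum>k\<in>UNIV. A $ i $ k * (if k = j \<and> k \<subseteq> S then 1 else 0)) = A $ i $ j" for i j
      using that by (subst sum.remove[of _ j]) (auto simp: ops_on_def)
    then show ?thesis by (simp add: matrix_matrix_mult_def id_on_def vec_eq_iff)
  qed
  have dagops: "dagger A \<in> ops_on S" if "A \<in> ops_on S" for A
    using that by (auto simp: ops_on_def dagger_def cconj_def transpose_def)
  have ops: "A ** B \<in> ops_on S" if "A \<in> ops_on S" "B \<in> ops_on S" for A B
  proof -
    have "(A ** B) $ x $ y = 0" if "\<not> (x \<subseteq> S \<and> y \<subseteq> S)" for x y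
    proof (cases "x \<subseteq> S")
      case True
      then show ?thesis
        using that(1) ops_on_outside[OF \<open>B \<in> ops_on S\<close>] by (simp add: matrix_matrix_mult_def)
    next
      case False
      then show ?thesis
        using ops_on_outside[OF \<open>A \<in> ops_on S\<close>] by (simp add: matrix_matrix_mult_def)
    qed
    then show ?thesis unfolding ops_on_def by blast
  qed
  have grp: "V ** U \<in> unitary_group S" if U: "U \<in> unitary_group S" for U
  proof -
    have "dagger (V ** U) ** (V ** U) = (dagger U ** (dagger V ** V)) ** U"
      by (simp add: dag matrix_mul_assoc)
    moreover have "(V ** U) ** dagger (V ** U) = (V ** (U ** dagger U)) ** dagger V"
      by (simp add: dag matrix_mul_assoc)
    ultimately show ?thesis
      using U V by (simp add: unitary_group_def ops idr dagops)
  qed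
  have "(\<lambda>U. V ** U) \<in> borel_measurable borel"
    by (rule borel_measurable_continuous_onI) (auto simp: matrix_matrix_mult_def intro!: continuous_intros)
  then have "(\<lambda>U. V ** U) \<in> measurable \<mu> (restrict_space borel (unitary_group S))"
    by (intro measurable_restrict_space2 haar_measure_borel[OF \<mu>]) (auto simp: sp grp)
  then have meas: "(\<lambda>U. V ** U) \<in> measurable \<mu> \<mu>"
    using st measurable_cong_sets by blast
  have "(\<integral>U. \<phi> U \<partial>\<mu>) = (\<integral>U. \<phi> U \<partial>(distr \<mu> \<mu> (\<lambda>U. V ** U)))"
    using \<mu> V by (simp add: haar_measure_def)
  also have "\<dots> = (\<integral>U. \<phi> (V ** U) \<partial>\<mu>)"
    by (rule integral_distr[OF meas haar_measure_borel[OF \<mu> \<phi>]])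
  finally show ?thesis by simp
qed

section \<open>Test unitaries: phases, transpositions and Hadamard rotations\<close>

lemma hermitian_unitary_groupI:
  "V \<in> ops_on S \<Longrightarrow> dagger V = V \<Longrightarrow> V ** V = id_on S \<Longrightarrow> V \<in> unitary_group S"
  by (simp add: unitary_group_def)

text \<open>Under this unitary an entry of a commuting operator acquires \<open>\<i>\<close> to the
  power of the number of p among c, d minus the number of p among a, b. The exponent lies between -2
  and 2, so the phase is 1 only for exponent 0; a sign -1 in place of \<open>\<i>\<close> would miss
  the exponents 2 and -2.\<close>

lemma phase_unitary:
  fixes p :: "'q::finite set" and U :: "'q qop"
  assumes V: "V = (\<chi> i j. if i = j \<and> i \<subseteq> S then if i = p then \<i> else 1 else 0)"
  shows "V \<in> unitary_group S" "c \<subseteq> S \<Longrightarrow> (V ** U) $ c $ z = (if c = p then \<i> else 1) * U $ c $ z"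
proof -
  have mult: "(V ** U) $ c $ z = (if c \<subseteq> S then (if c = p then \<i> else 1) * U $ c $ z else 0)" for U :: "'q qop" and c z
    unfolding matrix_matrix_mult_def V
    by (simp add: if_distrib[of "\<lambda>t. t * _"] cong: if_cong)
  then show "c \<subseteq> S \<Longrightarrow> (V ** U) $ c $ z = (if c = p then \<i> else 1) * U $ c $ z" by simp
  have dag: "dagger V = (\<chi> i j. if i = j \<and> i \<subseteq> S then if i = p then - \<i> else 1 else 0)"
    by (auto simp: V dagger_def cconj_def transpose_def vec_eq_iff)
  have "V ** dagger V = id_on S"
    by (auto simp: vec_eq_iff mult dag id_on_def)
  moreover have "dagger V ** V = id_on S"
  proof -
    have "(dagger V ** V) $ i $ j = (\<Sum>k\<in>UNIV. if k = i then if i = j \<and> i \<subseteq> S then 1 else 0 else 0)" for i j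
      unfolding matrix_matrix_mult_def vec_lambda_beta dag
      by (rule sum.cong) (auto simp: V)
    then show ?thesis by (simp add: vec_eq_iff id_on_def)
  qed
  moreover have "V \<in> ops_on S"
    by (auto simp: V ops_on_def split: if_splits)
  ultimately show "V \<in> unitary_group S"
    by (simp add: unitary_group_def)
qed

text \<open>Permuting basis vectors shows that the entries of a commuting operator depend only on
  the coincidence pattern of their four indices.\<close>

lemma transposition_unitary:
  fixes s t :: "'q::finite set" and U :: "'q qop"
  assumes V: "V = (\<chi> i j. if i \<subseteq> S \<and> j = Transposition.transpose s t i then 1 else 0)"
    and st: "s \<subseteq> S" "t \<subseteq> S"
  shows "V \<in> unitary_group S" "c \<subseteq> S \<Longrightarrow> (V ** U) $ c $ z = U $ (Transposition.transpose s t c) $ z"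
proof -
  have mult: "(V ** U) $ c $ z = (if c \<subseteq> S then U $ (Transposition.transpose s t c) $ z else 0)" for U :: "'q qop" and c z
    unfolding matrix_matrix_mult_def V
    by (simp add: if_distrib[of "\<lambda>t. t * _"] cong: if_cong)
  show "(V ** U) $ c $ z = U $ (Transposition.transpose s t c) $ z" if "c \<subseteq> S"
    unfolding mult using that by simp
  have sub: "Transposition.transpose s t c \<subseteq> S \<longleftrightarrow> c \<subseteq> S" for c
    using st by (auto simp: Transposition.transpose_def)
  have sw: "j = Transposition.transpose s t i \<longleftrightarrow> i = Transposition.transpose s t j" for i j
    by auto
  show "V \<in> unitary_group S"
  proof (rule hermitian_unitary_groupI)
    show "V \<in> ops_on S" using sub by (auto simp: V ops_on_def split: if_splits)
    show "dagger V = V"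
      using sub sw by (auto simp: V dagger_def cconj_def transpose_def vec_eq_iff)
    show "V ** V = id_on S"
      unfolding vec_eq_iff mult by (auto simp: V id_on_def sub)
  qed
qed

text \<open>Phases and permutations leave the value at four equal indices unrelated to the other
  values; a unitary mixing two basis vectors supplies the missing relation, which is read off from
  row p.\<close>

lemma hadamard_unitary:
  fixes p q :: "'q::finite set" and U :: "'q qop"
  assumes V: "V = (\<chi> i j. if \<not> i \<subseteq> S \<or> \<not> j \<subseteq> S then 0
      else if i \<in> {p, q} \<and> j \<in> {p, q} then complex_of_real ((if i = q \<and> j = q then - 1 else 1) / sqrt 2)
      else of_bool (i = j))"
    and pq: "p \<subseteq> S" "q \<subseteq> S" "p \<noteq> q"
  shows "V \<in> unitary_group S" "(V ** U) $ p $ z = (\<Sum>k\<in>{p, q}. complex_of_real (1 / sqrt 2) * U $ k $ z)"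
proof -
  let ?h = "complex_of_real (1 / sqrt 2)"
  have hh: "?h * ?h = 1 / 2"
    by (simp flip: of_real_mult)
  have p: "(V ** U) $ p $ z = ?h * (U $ p $ z + U $ q $ z)" for U :: "'q qop" and z
  proof -
    have "(V ** U) $ p $ z = (\<Sum>k\<in>{p, q}. V $ p $ k * U $ k $ z)"
      unfolding matrix_matrix_mult_def vec_lambda_beta
      by (rule sum.mono_neutral_right) (use pq in \<open>auto simp: V\<close>)
    then show ?thesis using pq by (simp add: V algebra_simps)
  qed
  have q: "(V ** U) $ q $ z = ?h * (U $ p $ z - U $ q $ z)" for U :: "'q qop" and z
  proof -
    have "(V ** U) $ q $ z = (\<Sum>k\<in>{p, q}. V $ q $ k * U $ k $ z)"
      unfolding matrix_matrix_mult_def vec_lambda_beta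
      by (rule sum.mono_neutral_right) (use pq in \<open>auto simp: V\<close>)
    then show ?thesis using pq by (simp add: V algebra_simps)
  qed
  have other: "(V ** U) $ c $ z = (if c \<subseteq> S then U $ c $ z else 0)" if "c \<noteq> p" "c \<noteq> q" for U :: "'q qop" and c z
  proof -
    have "(V ** U) $ c $ z = (\<Sum>k\<in>{c}. V $ c $ k * U $ k $ z)"
      unfolding matrix_matrix_mult_def vec_lambda_beta
      by (rule sum.mono_neutral_right) (use that in \<open>auto simp: V\<close>)
    then show ?thesis using that by (simp add: V)
  qed
  show "(V ** U) $ p $ z = (\<Sum>k\<in>{p, q}. ?h * U $ k $ z)"
    using pq p by (simp add: algebra_simps)
  show "V \<in> unitary_group S"
  proof (rule hermitian_unitary_groupI)
    show "V \<in> ops_on S" by (auto simp: V ops_on_def split: if_splits)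
    show "dagger V = V"
      by (auto simp: V dagger_def cconj_def transpose_def vec_eq_iff)
    have Vp: "V $ p $ z = (if z \<in> {p, q} then ?h else 0)" for z
      using pq by (auto simp: V)
    have Vq: "V $ q $ z = (if z = p then ?h else if z = q then - ?h else 0)" for z
      using pq by (auto simp: V)
    have "(V ** V) $ c $ z = id_on S $ c $ z" for c z
    proof -
      consider "c = p" | "c = q" | "c \<noteq> p" "c \<noteq> q" by blast
      then show ?thesis
      proof cases
        case 1
        then show ?thesis using pq hh by (auto simp: p Vp Vq id_on_def algebra_simps)
      next
        case 2
        then show ?thesis using pq hh by (auto simp: q Vp Vq id_on_def algebra_simps)
      next
        case 3
        then have "V $ c $ z = (if c = z \<and> c \<subseteq> S then 1 else 0)"
          by (auto simp: V)
        then have "(V ** V) $ c $ z = (if c = z \<and> c \<subseteq> S then 1 else 0)"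
          unfolding other[OF 3] by (cases "c = z") simp_all
        then show ?thesis by (simp add: id_on_def)
      qed
    qed
    then show "V ** V = id_on S" by (simp add: vec_eq_iff)
  qed
qed

section \<open>The commutant and the resulting moments\<close>

lemma sum_times4:
  fixes p q r s :: "'a \<Rightarrow> 'b::comm_semiring_1"
  shows "sum p A * sum q B * sum r C * sum s D = (\<Sum>i\<in>A. \<Sum>j\<in>B. \<Sum>k\<in>C. \<Sum>l\<in>D. p i * q j * r k * s l)"
  by (simp only: sum_distrib_left[symmetric] sum_distrib_right[symmetric])

text \<open>\<open>f\<close> holds the entries of an operator commuting with all \<open>V \<otimes> V\<close>; the three hypotheses are the
  commutation relations for diagonal \<open>V\<close>, for transpositions of basis vectors, and for a Hadamard
  rotation in the plane of \<open>p\<close> and \<open>q\<close>.\<close>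

lemma commutant_form:
  fixes f :: "'a \<Rightarrow> 'a \<Rightarrow> 'a \<Rightarrow> 'a \<Rightarrow> complex"
  assumes zero: "\<And>c d a b. \<lbrakk>c \<in> T; d \<in> T; a \<in> T; b \<in> T; \<not> (c = a \<and> d = b \<or> c = b \<and> d = a)\<rbrakk>
      \<Longrightarrow> f c d a b = 0"
    and tr: "\<And>s t c d a b. \<lbrakk>s \<in> T; t \<in> T; c \<in> T; d \<in> T; a \<in> T; b \<in> T\<rbrakk> \<Longrightarrow>
      f c d a b = f (Transposition.transpose s t c) (Transposition.transpose s t d)
        (Transposition.transpose s t a) (Transposition.transpose s t b)"
    and had: "f p p p p = (\<Sum>i\<in>{p,q}. \<Sum>j\<in>{p,q}. \<Sum>k\<in>{p,q}. \<Sum>l\<in>{p,q}. f i j k l) / 4"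
    and pq: "p \<in> T" "q \<in> T" "p \<noteq> q"
    and T: "c \<in> T" "d \<in> T" "a \<in> T" "b \<in> T"
  shows "f c d a b = f p q p q * of_bool (c = a \<and> d = b) + f p q q p * of_bool (c = b \<and> d = a)"
proof -
  have off: "f c d c d = f p q p q" "f c d d c = f p q q p"
    if cd: "c \<in> T" "d \<in> T" "c \<noteq> d" for c d
  proof -
    \<comment> \<open>\<open>?s\<close> carries c to p; \<open>?t\<close> then carries the image of
      d to q and keeps p fixed, since neither that image nor q equals p.\<close>
    let ?s = "Transposition.transpose c p"
    let ?t = "Transposition.transpose (?s d) q"
    have d: "?s d \<in> T" "?s d \<noteq> p" using cd pq by (auto simp: Transposition.transpose_def)
    have "?t p = p" "?t (?s d) = q" using d pq by auto
    then show "f c d c d = f p q p q" "f c d d c = f p q q p"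
      using tr[of c p c d c d] tr[of "?s d" q p "?s d" p "?s d"]
        tr[of c p c d d c] tr[of "?s d" q p "?s d" "?s d" p] cd pq d
      by simp_all
  qed
  have diag: "f c c c c = f p p p p" if "c \<in> T" for c
    using tr[of c p c c c c] that pq by simp
  have "4 * f p p p p = (\<Sum>i\<in>{p,q}. \<Sum>j\<in>{p,q}. \<Sum>k\<in>{p,q}. \<Sum>l\<in>{p,q}. f i j k l)"
  proof -
    have "4 * x = y" if "x = y / 4" for x y :: complex
      unfolding that by simp
    from this[OF had] show ?thesis .
  qed
  \<comment> \<open>Of the sixteen terms six survive \<open>zero\<close>: two with equal indices,
    which agree by \<open>diag\<close>, and two of each off-diagonal kind.\<close>
  also have "\<dots> = 2 * f p p p p + 2 * (f p q p q + f p q q p)"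
    using pq off[of q p] diag[of q] by (simp add: zero)
  finally have "2 * f p p p p = 2 * (f p q p q + f p q q p)" by (simp add: algebra_simps)
  then have diag': "f p p p p = f p q p q + f p q q p"
    unfolding mult_cancel_left by simp
  consider "\<not> (c = a \<and> d = b \<or> c = b \<and> d = a)" | "c = d" "a = c" "b = c"
    | "c \<noteq> d" "a = c" "b = d" | "c \<noteq> d" "a = d" "b = c"
    by blast
  then show ?thesis
  proof cases
    case 1
    then have "\<not> (c = a \<and> d = b)" "\<not> (c = b \<and> d = a)"
      by blast+
    then show ?thesis
      unfolding zero[OF T 1] by (simp only: of_bool_eq mult_zero_right add_0)
  next
    case 2
    then show ?thesis using diag[OF T(1)] diag' by simp
  next
    case 3
    then show ?thesis using off(1)[OF T(1,2)] by simp
  next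
    case 4
    then show ?thesis using off(2)[OF T(1,2)] by simp
  qed
qed

lemma bounded_rv_unitary_entry:
  assumes "F \<in> borel_measurable M" "\<And>\<omega>. \<omega> \<in> space M \<Longrightarrow> F \<omega> \<in> unitary_group S"
  shows "bounded_rv M (\<lambda>\<omega>. F \<omega> $ i $ j)"
  unfolding bounded_rv_def using measurable_entry[OF assms(1)] unitary_group_norm_le[OF assms(2)]
  by blast

lemma unitary_group_cols:
  assumes U: "U \<in> unitary_group S" and "x \<subseteq> S" "z \<subseteq> S"
  shows "(\<Sum>c\<in>Pow S. U $ c $ z * cnj (U $ c $ x)) = of_bool (z = x)"
proof -
  have "(\<Sum>c\<in>Pow S. U $ c $ z * cnj (U $ c $ x)) = (\<Sum>c\<in>UNIV. U $ c $ z * cnj (U $ c $ x))"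
    using ops_on_outside[of U S] U by (intro sum.mono_neutral_left) (simp_all add: unitary_group_def)
  also have "\<dots> = (dagger U ** U) $ x $ z"
    by (simp add: matrix_matrix_mult_def dagger_def cconj_def transpose_def mult.commute)
  also have "\<dots> = of_bool (z = x)"
    using assms by (auto simp: unitary_group_def id_on_def)
  finally show ?thesis .
qed

lemma sum_Pow_of_bool:
  fixes S :: "'q::finite set"
  shows "(\<Sum>c\<in>Pow S. \<Sum>d\<in>Pow S. of_bool (c = d \<and> d = c)) = (2 ^ card S :: complex)"
proof -
  have "of_bool (c = d \<and> d = c) = (if c = d then 1 else 0 :: complex)" for c d :: "'q set"
    by auto
  then show ?thesis by (simp add: card_Pow)
qed

text \<open>For fixed z, w, x, y, left invariance makes the integrals, indexed by c, d, a, b, the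
  entries of an operator commuting with all \<open>V \<otimes> V\<close>, hence a combination of the
  unit and SWAP. Two traces fix the coefficients, and the result is rewritten in the orthogonal pair
  \<open>1/D\<close> and \<open>SWAP - 1/D\<close>.\<close>

lemma haar_moment:
  fixes S :: "'q::finite set"
  assumes \<mu>: "haar_measure S \<mu>" and S: "S \<noteq> {}"
    and zw: "z \<subseteq> S" "w \<subseteq> S" "x \<subseteq> S" "y \<subseteq> S" and cd: "c \<subseteq> S" "d \<subseteq> S" "a \<subseteq> S" "b \<subseteq> S"
  shows "(\<integral>U. U $ c $ z * U $ d $ w * cnj (U $ a $ x) * cnj (U $ b $ y) \<partial>\<mu>) =
    (\<Sum>k\<in>UNIV. factor_kernel S k c d a b * factor_kernel S k z w x y / factor_dim S k)"
proof -
  define \<phi> where "\<phi> = (\<lambda>c d a b (U :: 'q qop). U $ c $ z * U $ d $ w * cnj (U $ a $ x) * cnj (U $ b $ y))"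
  define f where "f c d a b = (\<integral>U. \<phi> c d a b U \<partial>\<mu>)" for c d a b
  have fin: "finite_measure \<mu>" and ps: "prob_space \<mu>" and sp: "space \<mu> = unitary_group S"
    using \<mu> by (auto simp: haar_measure_def prob_space_def)
  have bU: "bounded_rv \<mu> (\<lambda>U. U $ i $ j)" for i j
    by (rule bounded_rv_unitary_entry) (auto simp: sp intro: haar_measure_borel[OF \<mu>])
  have bphi: "bounded_rv \<mu> (\<phi> c d a b)" for c d a b
    unfolding \<phi>_def by (intro bounded_rv_mult bounded_rv_cnj bU)
  have mphi: "\<phi> c d a b \<in> borel_measurable borel" for c d a b
    unfolding \<phi>_def by (rule borel_measurable_continuous_onI) (intro continuous_intros)
  have inv: "f c d a b = (\<integral>U. \<phi> c d a b (V ** U) \<partial>\<mu>)" if "V \<in> unitary_group S" for c d a b V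
    unfolding f_def by (rule haar_measure_left_invariant[OF \<mu> that mphi, symmetric])
  \<comment> \<open>The two reference basis vectors of the commutant are taken to be
    \<open>{}\<close> and any nonempty subset q of S.\<close>
  have form: "f c d a b = f {} q {} q * of_bool (c = a \<and> d = b) + f {} q q {} * of_bool (c = b \<and> d = a)"
    if q: "q \<in> Pow S" "q \<noteq> {}" and T: "c \<in> Pow S" "d \<in> Pow S" "a \<in> Pow S" "b \<in> Pow S" for q c d a b
  proof (rule commutant_form[where T = "Pow S"])
    fix c d a b
    assume T: "c \<in> Pow S" "d \<in> Pow S" "a \<in> Pow S" "b \<in> Pow S"
      and ne: "\<not> (c = a \<and> d = b \<or> c = b \<and> d = a)"
    define r where "r p i = (if i = p then \<i> else 1)" for p i :: "'q set"
    have scale: "f c d a b = r p c * r p d * cnj (r p a) * cnj (r p b) * f c d a b" for p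
    proof -
      define V :: "'q qop" where "V = (\<chi> i j. if i = j \<and> i \<subseteq> S then if i = p then \<i> else 1 else 0)"
      have V: "(V ** U) $ e $ v = r p e * U $ e $ v" if "e \<in> Pow S" for e v and U :: "'q qop"
        using phase_unitary(2)[OF V_def] that by (simp add: r_def)
      have "f c d a b = (\<integral>U. \<phi> c d a b (V ** U) \<partial>\<mu>)"
        by (rule inv[OF phase_unitary(1)[OF V_def]])
      also have "\<dots> = (\<integral>U. r p c * r p d * cnj (r p a) * cnj (r p b) * \<phi> c d a b U \<partial>\<mu>)"
        unfolding \<phi>_def V[OF T(1)] V[OF T(2)] V[OF T(3)] V[OF T(4)] complex_cnj_mult by (simp only: mult_ac)
      finally show ?thesis by (simp add: f_def)
    qed
    show "f c d a b = 0"
    proof (rule ccontr)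
      assume "f c d a b \<noteq> 0"
      then have 1: "r p c * r p d * cnj (r p a) * cnj (r p b) = 1" for p
        using scale[of p] by simp
      \<comment> \<open>Taking p = c and p = d, the phases force c and d to occur as often in (a, b)
        as in (c, d), so one pair is a rearrangement of the other, contrary to
        \<open>ne\<close>.\<close>
      show False
        using 1[of c] 1[of d] ne by (simp add: r_def complex_eq_iff split: if_splits)
    qed
  next
    fix s t c d a b
    assume st: "s \<in> Pow S" "t \<in> Pow S" and T: "c \<in> Pow S" "d \<in> Pow S" "a \<in> Pow S" "b \<in> Pow S"
    let ?t = "Transposition.transpose s t"
    define V :: "'q qop" where "V = (\<chi> i j. if i \<subseteq> S \<and> j = ?t i then 1 else 0)"
    have st': "s \<subseteq> S" "t \<subseteq> S" using st by auto
    have V: "(V ** U) $ e $ v = U $ ?t e $ v" if "e \<in> Pow S" for e v and U :: "'q qop"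
      using transposition_unitary(2)[OF V_def st'] that by simp
    have "f c d a b = (\<integral>U. \<phi> c d a b (V ** U) \<partial>\<mu>)"
      by (rule inv[OF transposition_unitary(1)[OF V_def st']])
    also have "\<dots> = f (?t c) (?t d) (?t a) (?t b)"
      unfolding \<phi>_def f_def V[OF T(1)] V[OF T(2)] V[OF T(3)] V[OF T(4)] ..
    finally show "f c d a b = f (?t c) (?t d) (?t a) (?t b)" .
  next
    define V :: "'q qop" where "V = (\<chi> i j. if \<not> i \<subseteq> S \<or> \<not> j \<subseteq> S then 0
      else if i \<in> {{}, q} \<and> j \<in> {{}, q} then complex_of_real ((if i = q \<and> j = q then - 1 else 1) / sqrt 2)
      else of_bool (i = j))"
    let ?h = "complex_of_real (1 / sqrt 2)"
    have pq: "{} \<subseteq> S" "q \<subseteq> S" "{} \<noteq> q" using q by auto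
    have h4: "?h * ?h * ?h * ?h = 1 / 4"
    proof -
      have "?h * ?h = 1 / 2" by (simp flip: of_real_mult)
      then show ?thesis by (simp add: mult.assoc)
    qed
    have V: "(V ** U) $ {} $ v = (\<Sum>k\<in>{{}, q}. ?h * U $ k $ v)" for v and U :: "'q qop"
      by (rule hadamard_unitary(2)[OF V_def pq])
    have expand: "\<phi> {} {} {} {} (V ** U) =
      (\<Sum>i\<in>{{},q}. \<Sum>j\<in>{{},q}. \<Sum>k\<in>{{},q}. \<Sum>l\<in>{{},q}. 1 / 4 * \<phi> i j k l U)" for U
    proof -
      have "\<phi> {} {} {} {} (V ** U) = (\<Sum>k\<in>{{}, q}. ?h * U $ k $ z) * (\<Sum>k\<in>{{}, q}. ?h * U $ k $ w) *
          (\<Sum>k\<in>{{}, q}. ?h * cnj (U $ k $ x)) * (\<Sum>k\<in>{{}, q}. ?h * cnj (U $ k $ y))"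
        unfolding \<phi>_def V cnj_sum by simp
      also have "\<dots> = (\<Sum>i\<in>{{},q}. \<Sum>j\<in>{{},q}. \<Sum>k\<in>{{},q}. \<Sum>l\<in>{{},q}.
          ?h * ?h * ?h * ?h * \<phi> i j k l U)"
        unfolding sum_times4 \<phi>_def by (intro sum.cong refl) (simp only: mult_ac)
      finally show ?thesis unfolding h4 .
    qed
    have "f {} {} {} {} = (\<integral>U. \<phi> {} {} {} {} (V ** U) \<partial>\<mu>)"
      by (rule inv[OF hadamard_unitary(1)[OF V_def pq]])
    also have "\<dots> = (\<Sum>i\<in>{{},q}. \<Sum>j\<in>{{},q}. \<Sum>k\<in>{{},q}. \<Sum>l\<in>{{},q}. 1 / 4 * f i j k l)"
    proof -
      have int: "integrable \<mu> (\<lambda>U. 1 / 4 * \<phi> i j k l U)" for i j k l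
        by (intro bounded_rv_integrable[OF fin] bounded_rv_mult bounded_rv_const bphi)
      show ?thesis
        unfolding expand f_def
        by (simp only: Bochner_Integration.integral_sum Bochner_Integration.integrable_sum int integral_mult_right_zero)
    qed
    finally show "f {} {} {} {} =
      (\<Sum>i\<in>{{},q}. \<Sum>j\<in>{{},q}. \<Sum>k\<in>{{},q}. \<Sum>l\<in>{{},q}. f i j k l) / 4"
      by (simp only: sum_divide_distrib times_divide_eq_left mult_1)
  qed (use q T in auto)
  \<comment> \<open>S itself serves as the nonempty subset q.\<close>
  obtain \<alpha> \<beta> where ab: "\<And>c d a b. c \<subseteq> S \<Longrightarrow> d \<subseteq> S \<Longrightarrow> a \<subseteq> S \<Longrightarrow> b \<subseteq> S \<Longrightarrow>
      f c d a b = \<alpha> * of_bool (c = a \<and> d = b) + \<beta> * of_bool (c = b \<and> d = a)"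
    using form[of S] S by blast
  define D :: complex where "D = 2 ^ card S"
  have DD: "4 ^ card S = D * D"
    unfolding D_def by (simp flip: power_mult_distrib)
  \<comment> \<open>As S is nonempty, D is at least 2, so \<open>D * D - 1\<close> is nonzero and
    may be cancelled below.\<close>
  have "(4 :: nat) ^ card S \<noteq> 1" using S by simp
  then have "(4 :: complex) ^ card S \<noteq> 1"
    by (metis of_nat_1 of_nat_eq_iff of_nat_numeral of_nat_power)
  then have D: "D \<noteq> 0" "D * D - 1 \<noteq> 0" by (auto simp: DD) (simp add: D_def)
  define P Q :: complex where "P = of_bool (z = x \<and> w = y)" and "Q = of_bool (z = y \<and> w = x)"
  have integral1: "(\<integral>U. C \<partial>\<mu>) = C" for C :: complex
    using prob_space.prob_space[OF ps] by simp
  \<comment> \<open>The traces against \<open>\<one>\<close> and \<open>SWAP\<close>, which unitarity makes constant, determine \<open>\<alpha>\<close> and \<open>\<beta>\<close>.\<close>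
  have direct: "D * D * \<alpha> + D * \<beta> = P"
  proof -
    have "(\<Sum>c\<in>Pow S. \<Sum>d\<in>Pow S. f c d c d) = (\<integral>U. (\<Sum>c\<in>Pow S. \<Sum>d\<in>Pow S. \<phi> c d c d U) \<partial>\<mu>)"
      unfolding f_def
      by (simp only: Bochner_Integration.integral_sum Bochner_Integration.integrable_sum
        bounded_rv_integrable[OF fin bphi])
    also have "\<dots> = (\<integral>U. P \<partial>\<mu>)"
    proof (rule Bochner_Integration.integral_cong[OF refl])
      fix U assume "U \<in> space \<mu>"
      then have U: "U \<in> unitary_group S" by (simp add: sp)
      have "(\<Sum>c\<in>Pow S. \<Sum>d\<in>Pow S. \<phi> c d c d U) =
          (\<Sum>c\<in>Pow S. U $ c $ z * cnj (U $ c $ x)) * (\<Sum>d\<in>Pow S. U $ d $ w * cnj (U $ d $ y))"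
        unfolding sum_product \<phi>_def by (intro sum.cong refl) (simp only: mult_ac)
      then show "(\<Sum>c\<in>Pow S. \<Sum>d\<in>Pow S. \<phi> c d c d U) = P"
        using zw by (simp add: unitary_group_cols[OF U] P_def of_bool_conj)
    qed
    also have "\<dots> = P" by (rule integral1)
    also have "(\<Sum>c\<in>Pow S. \<Sum>d\<in>Pow S. f c d c d) = (\<Sum>c\<in>Pow S. \<Sum>d\<in>Pow S. \<alpha> + \<beta> * of_bool (c = d \<and> d = c))"
      by (intro sum.cong refl) (simp add: ab)
    also have "\<dots> = D * D * \<alpha> + D * \<beta>"
      unfolding sum.distrib sum_distrib_left[symmetric] sum_Pow_of_bool
      by (simp add: card_Pow D_def)
    finally show ?thesis .
  qed
  have crossed: "D * \<alpha> + D * D * \<beta> = Q"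
  proof -
    have "(\<Sum>c\<in>Pow S. \<Sum>d\<in>Pow S. f c d d c) = (\<integral>U. (\<Sum>c\<in>Pow S. \<Sum>d\<in>Pow S. \<phi> c d d c U) \<partial>\<mu>)"
      unfolding f_def
      by (simp only: Bochner_Integration.integral_sum Bochner_Integration.integrable_sum
        bounded_rv_integrable[OF fin bphi])
    also have "\<dots> = (\<integral>U. Q \<partial>\<mu>)"
    proof (rule Bochner_Integration.integral_cong[OF refl])
      fix U assume "U \<in> space \<mu>"
      then have U: "U \<in> unitary_group S" by (simp add: sp)
      have "(\<Sum>c\<in>Pow S. \<Sum>d\<in>Pow S. \<phi> c d d c U) =
          (\<Sum>c\<in>Pow S. U $ c $ z * cnj (U $ c $ y)) * (\<Sum>d\<in>Pow S. U $ d $ w * cnj (U $ d $ x))"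
        unfolding sum_product \<phi>_def by (intro sum.cong refl) (simp only: mult_ac)
      then show "(\<Sum>c\<in>Pow S. \<Sum>d\<in>Pow S. \<phi> c d d c U) = Q"
        using zw by (simp add: unitary_group_cols[OF U] Q_def of_bool_conj)
    qed
    also have "\<dots> = Q" by (rule integral1)
    also have "(\<Sum>c\<in>Pow S. \<Sum>d\<in>Pow S. f c d d c) = (\<Sum>c\<in>Pow S. \<Sum>d\<in>Pow S. \<alpha> * of_bool (c = d \<and> d = c) + \<beta>)"
      by (intro sum.cong refl) (simp add: ab)
    also have "\<dots> = D * \<alpha> + D * D * \<beta>"
      unfolding sum.distrib sum_distrib_left[symmetric] sum_Pow_of_bool
      by (simp add: card_Pow D_def)
    finally show ?thesis .
  qed
  define I X :: complex where "I = of_bool (c = a \<and> d = b)" and "X = of_bool (c = b \<and> d = a)"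
  \<comment> \<open>Subtracting the direct equation, divided by D, from the crossed one isolates
    \<open>\<beta>\<close>, the coefficient of \<open>SWAP - 1/D\<close>; the remaining multiple of
    \<open>1/D\<close> is \<open>D * \<alpha> + \<beta>\<close>, which is the direct equation
    divided by D.\<close>
  have "(X - I / D) * (Q - P / D) / (D * D - 1) + I / D * (P / D) = \<alpha> * I + \<beta> * X"
  proof -
    have "Q - P / D = (D * D - 1) * \<beta>"
      using D(1) by (simp add: direct[symmetric] crossed[symmetric] field_simps)
    then have 1: "(X - I / D) * (Q - P / D) / (D * D - 1) = (X - I / D) * \<beta>"
      using D(2) by simp
    have 2: "P / D = D * \<alpha> + \<beta>"
      using D(1) by (simp add: direct[symmetric] field_simps)
    show ?thesis
      unfolding 1 unfolding 2 using D(1) by (simp add: field_simps)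
  qed
  moreover have "f c d a b = \<alpha> * I + \<beta> * X"
    using ab[OF cd] by (simp add: I_def X_def)
  moreover have "(\<Sum>k\<in>UNIV. factor_kernel S k c d a b * factor_kernel S k z w x y / factor_dim S k) =
      (X - I / D) * (Q - P / D) / (D * D - 1) + I / D * (P / D)"
  proof -
    have "(\<Sum>k\<in>UNIV. h k) = h True + h False" for h :: "bool \<Rightarrow> complex"
      by (simp add: UNIV_bool add.commute)
    then show ?thesis
      by (simp only: factor_kernel_def factor_dim_def if_True if_False DD D_def[symmetric]
        I_def X_def P_def Q_def div_by_1)
  qed
  ultimately show ?thesis
    by (simp only: f_def \<phi>_def)
qed

text \<open>The integral is one entry of the matrix equation defining a 2-design, in row ((c, d),
  (a, b)) and column ((z, w), (x, y)), so it takes the Haar value.\<close>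

lemma unitary_2_design_moment:
  fixes S :: "'q::finite set"
  assumes P: "prob_space P" and U: "unitary_2_design S P U" and S: "S \<noteq> {}"
    and zw: "z \<subseteq> S" "w \<subseteq> S" "x \<subseteq> S" "y \<subseteq> S" and cd: "c \<subseteq> S" "d \<subseteq> S" "a \<subseteq> S" "b \<subseteq> S"
  shows "(\<integral>\<omega>. U \<omega> $ c $ z * U \<omega> $ d $ w * cnj (U \<omega> $ a $ x) * cnj (U \<omega> $ b $ y) \<partial>P) =
    (\<Sum>k\<in>UNIV. factor_kernel S k c d a b * factor_kernel S k z w x y / factor_dim S k)"
proof -
  define K :: "'q qop \<Rightarrow> _" where "K V = kron (kron V V) (kron (cconj V) (cconj V))" for V
  obtain \<mu> where \<mu>: "haar_measure S \<mu>" and eq: "(\<integral>\<omega>. K (U \<omega>) \<partial>P) = (\<integral>V. K V \<partial>\<mu>)"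
    using U by (auto simp: unitary_2_design_def K_def)
  have K: "K V $ ((c, d), a, b) $ ((z, w), x, y) =
      V $ c $ z * V $ d $ w * cnj (V $ a $ x) * cnj (V $ b $ y)" for V
    by (simp add: K_def kron_def cconj_def)
  have "continuous_on UNIV K"
    unfolding K_def kron_def cconj_def by (intro continuous_intros)
  then have mK: "K \<in> borel_measurable borel"
    by (rule borel_measurable_continuous_onI)
  have bK: "norm (K V $ i $ j) \<le> 1" if "V \<in> unitary_group S" for V i j
  proof -
    have "norm (K V $ i $ j) \<le> 1 * 1 * (1 * 1)"
      unfolding K_def kron_def cconj_def vec_lambda_beta norm_mult complex_mod_cnj
      by (intro mult_mono unitary_group_norm_le[OF that] mult_nonneg_nonneg norm_ge_zero zero_le_one)
    then show ?thesis by simp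
  qed
  have "(\<integral>\<omega>. K (U \<omega>) $ i $ j \<partial>P) = (\<integral>V. K V $ i $ j \<partial>\<mu>)" for i j
  proof -
    have "(\<integral>\<omega>. K (U \<omega>) \<partial>P) $ i $ j = (\<integral>\<omega>. K (U \<omega>) $ i $ j \<partial>P)"
    proof (rule integral_entry[where C = 1])
      show "finite_measure P" using P by (simp add: prob_space_def)
      show "(\<lambda>\<omega>. K (U \<omega>)) \<in> borel_measurable P"
        by (rule measurable_compose[OF _ mK]) (use U in \<open>auto simp: unitary_2_design_def\<close>)
    qed (use U in \<open>auto simp: unitary_2_design_def intro: bK\<close>)
    moreover have "(\<integral>V. K V \<partial>\<mu>) $ i $ j = (\<integral>V. K V $ i $ j \<partial>\<mu>)"
    proof (rule integral_entry[where C = 1])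
      show "finite_measure \<mu>" using \<mu> by (auto simp: haar_measure_def prob_space_def)
      show "K \<in> borel_measurable \<mu>" by (rule haar_measure_borel[OF \<mu> mK])
    qed (use \<mu> in \<open>auto simp: haar_measure_def intro: bK\<close>)
    ultimately show ?thesis using eq by simp
  qed
  from this[of "((c, d), a, b)" "((z, w), x, y)"] haar_moment[OF \<mu> S zw cd]
  show ?thesis by (simp add: K)
qed

section \<open>Adjoints of quantum channels\<close>

definition unit_matrix :: "'n \<Rightarrow> 'n \<Rightarrow> complex^'n^'n" where
  "unit_matrix k l = (\<chi> i j. if i = k \<and> j = l then 1 else 0)"

text \<open>Each output entry is a fixed linear combination of input entries; this carries
  measurability, boundedness and compatibility with \<open>dagger\<close> through a channel.\<close>

lemma linear_map_entry:
  fixes \<Lambda> :: "complex^'n^'n \<Rightarrow> complex^'n^'n"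
  assumes "linear_map \<Lambda>"
  shows "\<Lambda> A $ i $ j = (\<Sum>k\<in>UNIV. \<Sum>l\<in>UNIV. A $ k $ l * \<Lambda> (unit_matrix k l) $ i $ j)"
proof -
  interpret L: Vector_Spaces.linear cscale cscale \<Lambda>
    using assms by (simp add: linear_map_def)
  have "(\<Sum>k\<in>UNIV. \<Sum>l\<in>UNIV. A $ k $ l * (if i = k \<and> j = l then 1 else 0)) = A $ i $ j" for i j
  proof -
    have "(\<Sum>l\<in>UNIV. A $ k $ l * (if i = k \<and> j = l then 1 else 0)) = (if i = k then A $ i $ j else 0)" for k
      by (cases "i = k") (simp_all add: if_distrib[of "\<lambda>t. _ * t"] cong: if_cong)
    then show ?thesis by simp
  qed
  then have "A = (\<Sum>k\<in>UNIV. \<Sum>l\<in>UNIV. cscale (A $ k $ l) (unit_matrix k l))"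
    by (simp add: vec_eq_iff cscale_def unit_matrix_def)
  then have "\<Lambda> A = \<Lambda> (\<Sum>k\<in>UNIV. \<Sum>l\<in>UNIV. cscale (A $ k $ l) (unit_matrix k l))"
    by (rule arg_cong)
  also have "\<dots> = (\<Sum>k\<in>UNIV. \<Sum>l\<in>UNIV. cscale (A $ k $ l) (\<Lambda> (unit_matrix k l)))"
    by (simp only: L.sum L.scale)
  finally show ?thesis
    by (simp only: sum_component cscale_def vec_lambda_beta)
qed

text \<open>Polarisation with the vectors \<open>e_i + c e_j\<close>: c = 0 treats the diagonal, c =
  1 the imaginary parts of the off-diagonal entries, and c = \<open>\<i>\<close> their real
  parts.\<close>

lemma real_form_dagger:
  fixes Y :: "complex^'n^'n"
  assumes "\<And>v. (\<Sum>i\<in>UNIV. cnj (v $ i) * (Y *v v) $ i) \<in> \<real>"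
  shows "dagger Y = Y"
proof -
  have real: "Y $ i $ i + c * Y $ i $ j + cnj c * Y $ j $ i + cnj c * c * Y $ j $ j \<in> \<real>" for i j c
  proof -
    let ?v = "\<chi> k. (if k = i then 1 else 0) + (if k = j then c else 0)"
    have "(Y *v ?v) $ k = Y $ k $ i + c * Y $ k $ j" for k
      by (simp add: matrix_vector_mult_def distrib_left sum.distrib if_distrib[of "\<lambda>t. _ * t"] cong: if_cong)
    then have "(\<Sum>k\<in>UNIV. cnj (?v $ k) * (Y *v ?v) $ k) =
      (\<Sum>k\<in>UNIV. (if k = i then Y $ k $ i + c * Y $ k $ j else 0) +
        (if k = j then cnj c * (Y $ k $ i + c * Y $ k $ j) else 0))"
      by (intro sum.cong refl) (simp add: distrib_right)
    also have "\<dots> = Y $ i $ i + c * Y $ i $ j + cnj c * Y $ j $ i + cnj c * c * Y $ j $ j"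
      by (simp add: sum.distrib distrib_left)
    finally show ?thesis using assms[of ?v] by simp
  qed
  have diag: "Im (Y $ i $ i) = 0" for i
    using real[of i 0 i] by (simp add: complex_is_Real_iff)
  have sym: "Im (Y $ i $ j) + Im (Y $ j $ i) = 0" "Re (Y $ i $ j) = Re (Y $ j $ i)" for i j
    using real[of i 1 j] real[of i \<i> j] diag[of i] diag[of j] by (simp_all add: complex_is_Real_iff)
  have "cnj (Y $ j $ i) = Y $ i $ j" for i j
  proof (rule complex_eqI)
    show "Re (cnj (Y $ j $ i)) = Re (Y $ i $ j)" "Im (cnj (Y $ j $ i)) = Im (Y $ i $ j)"
      using sym[of i j] by simp_all
  qed
  then show ?thesis
    by (simp add: vec_eq_iff dagger_def cconj_def transpose_def)
qed

text \<open>Complete positivity is applied with a single block: a positive rank-one matrix goes to a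
  matrix with nonnegative, hence real, quadratic form, and such a matrix is Hermitian.\<close>

lemma completely_positive_dagger_rank_one:
  fixes \<Lambda> :: "complex^'n^'n \<Rightarrow> complex^'n^'n"
  assumes "completely_positive \<Lambda>"
  shows "dagger (\<Lambda> (\<chi> i j. u i * cnj (u j))) = \<Lambda> (\<chi> i j. u i * cnj (u j))"
proof -
  let ?X = "\<chi> i j. u i * cnj (u j)"
  have "(\<Sum>i\<in>UNIV. cnj (v $ i) * (?X *v v) $ i) \<in> \<real>\<^sub>\<ge>\<^sub>0" for v
  proof -
    let ?s = "\<Sum>i\<in>UNIV. cnj (v $ i) * u i"
    have "(\<Sum>i\<in>UNIV. cnj (v $ i) * (?X *v v) $ i) = ?s * cnj ?s"
      by (simp add: matrix_vector_mult_def sum_product sum_distrib_left mult_ac) (rule sum.swap)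
    also have "\<dots> = complex_of_real ((norm ?s)\<^sup>2)"
      by (simp only: complex_norm_square)
    finally show ?thesis by simp
  qed
  then have "block_psd (Suc 0) (\<lambda>_ _. ?X)"
    by (simp add: block_psd_def)
  then have "block_psd (Suc 0) (\<lambda>_ _. \<Lambda> ?X)"
    using assms by (simp add: completely_positive_def)
  then have nonneg: "(\<Sum>i\<in>UNIV. cnj (v 0 $ i) * (\<Lambda> ?X *v v 0) $ i) \<in> \<real>\<^sub>\<ge>\<^sub>0"
    for v :: "nat \<Rightarrow> complex^'n"
    by (simp add: block_psd_def)
  have "(\<Sum>i\<in>UNIV. cnj (v $ i) * (\<Lambda> ?X *v v) $ i) \<in> \<real>" for v
    using nonneg[of "\<lambda>_. v"] nonneg_Reals_subset_Reals by auto
  then show ?thesis by (rule real_form_dagger)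
qed

text \<open>The rank-one matrices of \<open>u = e_k + c e_l\<close> control the images of the matrix
  units: c = 0 gives the diagonal units, while c = 1 and c = \<open>\<i>\<close> together separate
  the units (k, l) and (l, k). Linearity extends the result to all A.\<close>

lemma quantum_channel_dagger:
  fixes \<Lambda> :: "complex^'n^'n \<Rightarrow> complex^'n^'n"
  assumes "quantum_channel \<Lambda>"
  shows "\<Lambda> (dagger A) = dagger (\<Lambda> A)"
proof -
  have lin: "linear_map \<Lambda>" and cp: "completely_positive \<Lambda>"
    using assms by (simp_all add: quantum_channel_def)
  interpret L: Vector_Spaces.linear cscale cscale \<Lambda>
    using lin by (simp add: linear_map_def)
  let ?E = "\<lambda>k l. \<Lambda> (unit_matrix k l)"
  have herm: "\<Lambda> (unit_matrix k k) $ j $ i + c * \<Lambda> (unit_matrix l k) $ j $ i +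
      cnj c * \<Lambda> (unit_matrix k l) $ j $ i + c * cnj c * \<Lambda> (unit_matrix l l) $ j $ i =
    cnj (\<Lambda> (unit_matrix k k) $ i $ j + c * \<Lambda> (unit_matrix l k) $ i $ j +
      cnj c * \<Lambda> (unit_matrix k l) $ i $ j + c * cnj c * \<Lambda> (unit_matrix l l) $ i $ j)" for k l c i j
  proof -
    define u where "u i = (if i = k then 1 else 0) + (if i = l then c else 0)" for i
    have "(\<chi> i j. u i * cnj (u j)) = unit_matrix k k + cscale c (unit_matrix l k) +
        cscale (cnj c) (unit_matrix k l) + cscale (c * cnj c) (unit_matrix l l)"
      by (simp add: vec_eq_iff unit_matrix_def cscale_def u_def algebra_simps)
    then have exp: "\<Lambda> (\<chi> i j. u i * cnj (u j)) = ?E k k + cscale c (?E l k) +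
        cscale (cnj c) (?E k l) + cscale (c * cnj c) (?E l l)"
      by (simp only: L.add L.scale)
    have "\<Lambda> (\<chi> i j. u i * cnj (u j)) $ j $ i = cnj (\<Lambda> (\<chi> i j. u i * cnj (u j)) $ i $ j)"
      using completely_positive_dagger_rank_one[OF cp, of u]
      by (simp add: vec_eq_iff dagger_def cconj_def transpose_def)
    then show ?thesis unfolding exp by (simp add: cscale_def)
  qed
  have unit: "?E k l $ i $ j = cnj (?E l k $ j $ i)" for k l i j
  proof -
    have kk: "?E k k $ j $ i = cnj (?E k k $ i $ j)" for k
      using herm[of k j i 0 k] by simp
    have 1: "?E l k $ i $ j + ?E k l $ i $ j = cnj (?E l k $ j $ i) + cnj (?E k l $ j $ i)"
      using herm[of k i j 1 l] kk[of k] kk[of l] by (simp add: algebra_simps)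
    have 2: "\<i> * (?E l k $ i $ j - ?E k l $ i $ j) = \<i> * (cnj (?E k l $ j $ i) - cnj (?E l k $ j $ i))"
      using herm[of k i j \<i> l] kk[of k] kk[of l] by (simp add: algebra_simps)
    then have "?E l k $ i $ j - ?E k l $ i $ j = cnj (?E k l $ j $ i) - cnj (?E l k $ j $ i)"
      by (simp only: mult_cancel_left) simp
    with 1 have "2 * ?E k l $ i $ j = 2 * cnj (?E l k $ j $ i)"
      by (simp add: complex_eq_iff)
    then show ?thesis by simp
  qed
  have "\<Lambda> (dagger A) $ i $ j = cnj (\<Lambda> A $ j $ i)" for i j
  proof -
    have "\<Lambda> (dagger A) $ i $ j = (\<Sum>k\<in>UNIV. \<Sum>l\<in>UNIV. cnj (A $ l $ k) * ?E k l $ i $ j)"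
      by (subst linear_map_entry[OF lin]) (simp add: dagger_def cconj_def transpose_def)
    also have "\<dots> = (\<Sum>k\<in>UNIV. \<Sum>l\<in>UNIV. cnj (A $ l $ k * ?E l k $ j $ i))"
      by (subst unit) simp
    also have "\<dots> = (\<Sum>l\<in>UNIV. \<Sum>k\<in>UNIV. cnj (A $ l $ k * ?E l k $ j $ i))"
      by (rule sum.swap)
    also have "\<dots> = cnj (\<Lambda> A $ j $ i)"
      by (subst linear_map_entry[OF lin, of A]) (simp only: cnj_sum)
    finally show ?thesis .
  qed
  then show ?thesis
    by (simp add: vec_eq_iff dagger_def cconj_def transpose_def)
qed

text \<open>\<open>hs_inner\<close> conjugates its first argument, so the adjoint identity becomes a
  bilinear trace identity once the adjoint is known to send Hermitian B to a Hermitian matrix, a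
  property inherited from the channel.\<close>

lemma trace_hs_adjoint:
  fixes \<Lambda> :: "complex^'n^'n \<Rightarrow> complex^'n^'n"
  assumes \<Lambda>: "quantum_channel \<Lambda>" and B: "dagger B = B"
  shows "trace (B ** \<Lambda> A) = trace (A ** hs_adjoint \<Lambda> B)"
proof -
  have adj: "hs_inner (hs_adjoint \<Lambda> B) A = hs_inner B (\<Lambda> A)" for A
    using \<Lambda> by (intro hs_adjoint_eq) (simp add: quantum_channel_def)
  have dag: "hs_inner (dagger X) Y = cnj (hs_inner X (dagger Y))" for X Y :: "complex^'n^'n"
    unfolding hs_inner_sum dagger_def cconj_def transpose_def cnj_sum by (simp, rule sum.swap)
  have dd: "dagger (dagger X) = X" for X :: "complex^'n^'n"
    by (simp add: dagger_def cconj_def transpose_def vec_eq_iff)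
  have "hs_inner (dagger (hs_adjoint \<Lambda> B)) A = hs_inner (hs_adjoint \<Lambda> B) A" for A
  proof -
    have "hs_inner (dagger (hs_adjoint \<Lambda> B)) A = cnj (hs_inner B (dagger (\<Lambda> A)))"
      by (simp only: dag adj quantum_channel_dagger[OF \<Lambda>])
    also have "\<dots> = hs_inner (dagger B) (\<Lambda> A)" by (simp only: dag)
    finally show ?thesis by (simp only: B adj)
  qed
  then have "dagger (hs_adjoint \<Lambda> B) = hs_adjoint \<Lambda> B"
    by (metis hs_inner_real vector_eq_rdot)
  then have "trace (hs_adjoint \<Lambda> B ** A) = trace (B ** \<Lambda> A)"
    using adj[of A] B by (simp add: hs_inner_herm)
  then show ?thesis by (simp add: trace_mul_sym[of A])
qed

section \<open>Averaging over one layer\<close>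

lemma factor_kernel_transpose: "factor_kernel S k c d a b = factor_kernel S k a b c d"
proof -
  have "(c = b \<and> d = a) = (a = d \<and> b = c)" "(c = a \<and> d = b) = (a = c \<and> b = d)" by blast+
  then show ?thesis by (simp only: factor_kernel_def)
qed

lemma loc_kernel_transpose: "loc_kernel g \<kappa> c d a b = loc_kernel g \<kappa> a b c d"
  unfolding loc_kernel_def by (rule prod.cong[OF refl factor_kernel_transpose])

lemma sum_UNIV_prod: "(\<Sum>i\<in>UNIV. \<Sum>j\<in>UNIV. f i j) = (\<Sum>(i, j)\<in>UNIV. f i j)"
  by (simp add: sum.cartesian_product)

lemma trace_mult_pairs:
  "trace (B ** A) = (\<Sum>(c, a)\<in>UNIV. B $ c $ a * A $ a $ c)"
  by (simp add: trace_def matrix_matrix_mult_def sum_UNIV_prod)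

text \<open>This is \<open>Tr[\<Omega>\<^sub>\<kappa> (A \<otimes> A)]\<close> in coordinates: in
  the squared traces the sum over the basis is carried out first and gives the kernel.\<close>

lemma locality_vector_kernel:
  fixes g :: "'q::finite \<Rightarrow> 'm::finite"
  shows "locality_vector g A $ \<kappa> = (\<Sum>(c, a)\<in>UNIV. \<Sum>(d, b)\<in>UNIV.
    loc_kernel g \<kappa> c d a b * (A $ a $ c * A $ b $ d))"
proof -
  let ?S = "herm_basis g \<kappa>"
  have "locality_vector g A $ \<kappa> = (\<Sum>B\<in>?S. \<Sum>(c, a)\<in>UNIV. \<Sum>(d, b)\<in>UNIV.
      B $ c $ a * B $ d $ b * (A $ a $ c * A $ b $ d))"
    unfolding locality_vector_def vec_lambda_beta trace_mult_pairs power2_eq_square sum_product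
    by (intro sum.cong refl) (auto intro!: sum.cong)
  also have "\<dots> = (\<Sum>(c, a)\<in>UNIV. \<Sum>(d, b)\<in>UNIV. \<Sum>B\<in>?S.
      B $ c $ a * B $ d $ b * (A $ a $ c * A $ b $ d))"
    by (subst sum.swap, rule sum.cong[OF refl], clarsimp, subst sum.swap, rule sum.cong[OF refl], clarsimp)
  finally show ?thesis
    by (simp only: sum_distrib_right[symmetric] hermitian_onb_loc_kernel[OF hermitian_onb_herm_basis])
qed

text \<open>The kernel is symmetric under transposition, so the index pairs of A may be reversed.
  Entries of the state occur in this form in the averaged trace, those of the observable in the
  previous one.\<close>

lemma locality_vector_kernel':
  fixes g :: "'q::finite \<Rightarrow> 'm::finite"
  shows "locality_vector g A $ \<kappa> = (\<Sum>(c, a)\<in>UNIV. \<Sum>(d, b)\<in>UNIV.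
    loc_kernel g \<kappa> c d a b * (A $ c $ a * A $ d $ b))"
proof -
  let ?f = "\<lambda>c a d b. loc_kernel g \<kappa> c d a b * (A $ a $ c * A $ b $ d)"
  have "locality_vector g A $ \<kappa> = (\<Sum>c\<in>UNIV. \<Sum>a\<in>UNIV. \<Sum>d\<in>UNIV. \<Sum>b\<in>UNIV. ?f c a d b)"
    unfolding locality_vector_kernel sum_UNIV_prod[symmetric] ..
  also have "\<dots> = (\<Sum>a\<in>UNIV. \<Sum>c\<in>UNIV. \<Sum>d\<in>UNIV. \<Sum>b\<in>UNIV. ?f c a d b)"
    by (rule sum.swap)
  also have "\<dots> = (\<Sum>a\<in>UNIV. \<Sum>c\<in>UNIV. \<Sum>b\<in>UNIV. \<Sum>d\<in>UNIV. ?f c a d b)"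
    by (intro sum.cong refl sum.swap)
  also have "\<dots> = (\<Sum>a\<in>UNIV. \<Sum>c\<in>UNIV. \<Sum>b\<in>UNIV. \<Sum>d\<in>UNIV.
      loc_kernel g \<kappa> a b c d * (A $ a $ c * A $ b $ d))"
    by (subst loc_kernel_transpose) (rule refl)
  finally show ?thesis unfolding sum_UNIV_prod[symmetric] .
qed

text \<open>Arranged so that each summand contains four entries of W in the order of the moment
  formula.\<close>

lemma trace_conjugation_square:
  "(trace (conjugation W \<tau> ** H))\<^sup>2 = (\<Sum>(c, a)\<in>UNIV. \<Sum>(d, b)\<in>UNIV. \<Sum>(z, x)\<in>UNIV. \<Sum>(w, y)\<in>UNIV.
    H $ a $ c * H $ b $ d * (W $ c $ z * W $ d $ w * cnj (W $ a $ x) * cnj (W $ b $ y) *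
      (\<tau> $ z $ x * \<tau> $ w $ y)))"
proof -
  have entry: "conjugation W \<tau> $ c $ a = (\<Sum>(z, x)\<in>UNIV. W $ c $ z * cnj (W $ a $ x) * \<tau> $ z $ x)" for c a
  proof -
    have "conjugation W \<tau> $ c $ a = (\<Sum>x\<in>UNIV. \<Sum>z\<in>UNIV. W $ c $ z * cnj (W $ a $ x) * \<tau> $ z $ x)"
      by (simp add: conjugation_def matrix_matrix_mult_def dagger_def cconj_def transpose_def
        sum_distrib_left sum_distrib_right mult_ac)
    then show ?thesis by (subst (asm) sum.swap) (simp only: sum_UNIV_prod)
  qed
  have "(trace (conjugation W \<tau> ** H))\<^sup>2 = (\<Sum>(c, a)\<in>UNIV. \<Sum>(d, b)\<in>UNIV.
      H $ a $ c * H $ b $ d * (conjugation W \<tau> $ c $ a * conjugation W \<tau> $ d $ b))"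
    unfolding trace_mult_pairs power2_eq_square sum_product
    by (intro sum.cong refl) (auto intro!: sum.cong)
  also have "\<dots> = (\<Sum>(c, a)\<in>UNIV. \<Sum>(d, b)\<in>UNIV. \<Sum>(z, x)\<in>UNIV. \<Sum>(w, y)\<in>UNIV.
    H $ a $ c * H $ b $ d * (W $ c $ z * W $ d $ w * cnj (W $ a $ x) * cnj (W $ b $ y) *
      (\<tau> $ z $ x * \<tau> $ w $ y)))"
    unfolding entry sum_product
    by (intro sum.cong refl) (auto intro!: sum.cong simp: sum_distrib_left)
  finally show ?thesis .
qed


section \<open>Independence and the average over a fresh layer\<close>

lemma sum_prod_bool_fun:
  fixes h :: "'m::finite \<Rightarrow> bool \<Rightarrow> 'a::comm_semiring_1"
  shows "(\<Prod>m\<in>UNIV. \<Sum>k\<in>UNIV. h m k) = (\<Sum>\<kappa>\<in>UNIV. \<Prod>m\<in>UNIV. h m (\<kappa> m))"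
  by (subst prod_sum_PiE) auto

text \<open>Measurable functions of disjoint blocks of independent variables are independent. F may
  couple the earlier layers arbitrarily; their restricted tuple lies in the product space on which F
  is measurable.\<close>

lemma expectation_fresh_layer:
  fixes U :: "nat \<Rightarrow> 'm::finite \<Rightarrow> 'w \<Rightarrow> 'b::topological_space"
    and f :: "'m \<Rightarrow> 'b \<Rightarrow> complex"
  assumes P: "prob_space P"
    and ind: "prob_space.indep_vars P (\<lambda>_. borel) (\<lambda>(l, m). U l m) ({1..Suc n} \<times> UNIV)"
    and f: "\<And>m. f m \<in> borel_measurable borel"
    and F: "F \<in> borel_measurable (PiM ({1..n} \<times> UNIV) (\<lambda>_. borel))"
    and int_f: "\<And>m. integrable P (\<lambda>\<omega>. f m (U (Suc n) m \<omega>))"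
    and int_F: "integrable P (\<lambda>\<omega>. F (\<lambda>(l, m)\<in>{1..n} \<times> UNIV. U l m \<omega>))"
  shows "(\<integral>\<omega>. (\<Prod>m\<in>UNIV. f m (U (Suc n) m \<omega>)) * F (\<lambda>(l, m)\<in>{1..n} \<times> UNIV. U l m \<omega>) \<partial>P) =
    (\<Prod>m\<in>UNIV. \<integral>\<omega>. f m (U (Suc n) m \<omega>) \<partial>P) * (\<integral>\<omega>. F (\<lambda>(l, m)\<in>{1..n} \<times> UNIV. U l m \<omega>) \<partial>P)"
proof -
  interpret prob_space P by (rule P)
  \<comment> \<open>One block of variables for each factor of the last layer, and one for all earlier layers.\<close>
  define K where "K j = (case j of None \<Rightarrow> {1..n} \<times> UNIV | Some m \<Rightarrow> {(Suc n, m)})" for j :: "'m option"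
  define Y where "Y j = (case j of None \<Rightarrow> F | Some m \<Rightarrow> (\<lambda>x. f m (x (Suc n, m))))" for j
  have "indep_vars (\<lambda>j. PiM (K j) (\<lambda>_. borel)) (\<lambda>j \<omega>. restrict (\<lambda>i. (case i of (l, m) \<Rightarrow> U l m) \<omega>) (K j)) UNIV"
    by (rule indep_vars_restrict[OF ind]) (auto simp: K_def disjoint_family_on_def split: option.splits)
  moreover have "Y j \<in> borel_measurable (PiM (K j) (\<lambda>_. borel))" for j
  proof (cases j)
    case None
    then show ?thesis using F by (simp add: Y_def K_def)
  next
    case (Some m)
    have "(\<lambda>x. f m (x (Suc n, m))) \<in> borel_measurable (PiM {(Suc n, m)} (\<lambda>_. borel))"
      by (intro measurable_compose[OF _ f[of m]] measurable_component_singleton) simp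
    then show ?thesis using Some by (simp add: Y_def K_def)
  qed
  ultimately have ind': "indep_vars (\<lambda>_. borel)
      (\<lambda>j \<omega>. Y j (restrict (\<lambda>i. (case i of (l, m) \<Rightarrow> U l m) \<omega>) (K j))) UNIV"
    by (rule indep_vars_compose2)
  have None: "Y None (restrict (\<lambda>i. (case i of (l, m) \<Rightarrow> U l m) \<omega>) (K None)) =
      F (\<lambda>(l, m)\<in>{1..n} \<times> UNIV. U l m \<omega>)" for \<omega>
    by (simp add: Y_def K_def split_def)
  have Some: "Y (Some m) (restrict (\<lambda>i. (case i of (l, m) \<Rightarrow> U l m) \<omega>) (K (Some m))) =
      f m (U (Suc n) m \<omega>)" for m \<omega>
    by (simp add: Y_def K_def)
  have prod: "(\<Prod>j\<in>UNIV. h j) = (\<Prod>m\<in>UNIV. h (Some m)) * h None" for h :: "'m option \<Rightarrow> complex"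
    by (simp add: UNIV_option_conv prod.reindex mult.commute)
  have "integrable P (\<lambda>\<omega>. Y j (restrict (\<lambda>i. (case i of (l, m) \<Rightarrow> U l m) \<omega>) (K j)))" for j
    by (cases j) (simp_all only: None Some int_F int_f)
  from indep_vars_lebesgue_integral[OF finite ind' this]
  show ?thesis unfolding prod None Some .
qed

lemma sum_bilinear_factor:
  fixes F :: "'k \<Rightarrow> 'a \<Rightarrow> 'b \<Rightarrow> 'f::field"
  shows "(\<Sum>p\<in>A. \<Sum>q\<in>B. \<Sum>r\<in>C. \<Sum>s\<in>D. h p q * ((\<Sum>\<kappa>\<in>K. F \<kappa> p q * G \<kappa> r s / d \<kappa>) * t r s)) =
    (\<Sum>\<kappa>\<in>K. (\<Sum>p\<in>A. \<Sum>q\<in>B. F \<kappa> p q * h p q) / d \<kappa> * (\<Sum>r\<in>C. \<Sum>s\<in>D. G \<kappa> r s * t r s))"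
proof -
  have "(\<Sum>p\<in>A. \<Sum>q\<in>B. \<Sum>r\<in>C. \<Sum>s\<in>D. h p q * ((\<Sum>\<kappa>\<in>K. F \<kappa> p q * G \<kappa> r s / d \<kappa>) * t r s)) =
    (\<Sum>\<kappa>\<in>K. \<Sum>p\<in>A. \<Sum>q\<in>B. \<Sum>r\<in>C. \<Sum>s\<in>D. h p q * (F \<kappa> p q * G \<kappa> r s / d \<kappa> * t r s))"
    by (simp only: sum_distrib_left sum_distrib_right sum.swap[where B = K])
  also have "\<dots> = (\<Sum>\<kappa>\<in>K. (\<Sum>p\<in>A. \<Sum>q\<in>B. F \<kappa> p q * h p q) / d \<kappa> * (\<Sum>r\<in>C. \<Sum>s\<in>D. G \<kappa> r s * t r s))"
    unfolding sum_divide_distrib unfolding sum_distrib_right unfolding sum_distrib_left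
    by (intro sum.cong refl) (simp only: divide_inverse mult_ac)
  finally show ?thesis .
qed

text \<open>The operator \<open>\<tau>\<close> is a function t of the earlier unitaries, hence
  independent of the last layer. The moments of the factors multiply to two kernels, which contract
  separately with H and with \<open>\<tau>\<close> into locality vectors.\<close>

lemma twirl_expectation:
  fixes g :: "'q::finite \<Rightarrow> 'm::finite" and U :: "nat \<Rightarrow> 'm \<Rightarrow> 'w \<Rightarrow> 'q qop"
  assumes g: "surj g" and P: "prob_space P"
    and ind: "prob_space.indep_vars P (\<lambda>_. borel) (\<lambda>(l, m). U l m) ({1..Suc n} \<times> UNIV)"
    and des: "\<And>m. unitary_2_design (grp g m) P (U (Suc n) m)"
    and meas: "\<And>i j. (\<lambda>x. t x $ i $ j) \<in> borel_measurable (PiM ({1..n} \<times> UNIV) (\<lambda>_. borel))"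
    and bdd: "\<And>i j. bounded_rv P (\<lambda>\<omega>. t (\<lambda>(l, m)\<in>{1..n} \<times> UNIV. U l m \<omega>) $ i $ j)"
  defines "\<tau> \<equiv> \<lambda>\<omega>. t (\<lambda>(l, m)\<in>{1..n} \<times> UNIV. U l m \<omega>)"
  shows "(\<integral>\<omega>. (trace (conjugation (tensor g (\<lambda>m. U (Suc n) m \<omega>)) (\<tau> \<omega>) ** H))\<^sup>2 \<partial>P) =
    (\<Sum>\<kappa>\<in>UNIV. locality_vector g H $ \<kappa> / of_nat (loc_dim g \<kappa>) *
      (\<integral>\<omega>. locality_vector g (\<tau> \<omega>) $ \<kappa> \<partial>P))"
proof -
  have fin: "finite_measure P" using P by (simp add: prob_space_def)
  have b\<tau>: "bounded_rv P (\<lambda>\<omega>. \<tau> \<omega> $ i $ j)" for i j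
    unfolding \<tau>_def by (rule bdd)
  have bU: "bounded_rv P (\<lambda>\<omega>. U (Suc n) m \<omega> $ i $ j)" for m i j
    by (rule bounded_rv_unitary_entry[where S = "grp g m"]) (use des in \<open>auto simp: unitary_2_design_def\<close>)
  \<comment> \<open>Surjectivity of g excludes empty factors, as the moment formula of a single
    factor demands.\<close>
  have ne: "grp g m \<noteq> {}" for m
    using g by (auto simp: grp_def surj_def) metis
  let ?W = "\<lambda>\<omega>. tensor g (\<lambda>m. U (Suc n) m \<omega>)"
  have moment: "(\<integral>\<omega>. ?W \<omega> $ c $ z * ?W \<omega> $ d $ w * cnj (?W \<omega> $ a $ x) * cnj (?W \<omega> $ b $ y) *
      (\<tau> \<omega> $ z $ x * \<tau> \<omega> $ w $ y) \<partial>P) =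
    (\<Sum>\<kappa>\<in>UNIV. loc_kernel g \<kappa> c d a b * loc_kernel g \<kappa> z w x y / of_nat (loc_dim g \<kappa>)) *
      (\<integral>\<omega>. \<tau> \<omega> $ z $ x * \<tau> \<omega> $ w $ y \<partial>P)" for a b c d w x y z
  proof -
    define f where "f m V = V $ (c \<inter> grp g m) $ (z \<inter> grp g m) * V $ (d \<inter> grp g m) $ (w \<inter> grp g m) *
      cnj (V $ (a \<inter> grp g m) $ (x \<inter> grp g m)) * cnj (V $ (b \<inter> grp g m) $ (y \<inter> grp g m))"
      for m and V :: "'q qop"
    have prod: "?W \<omega> $ c $ z * ?W \<omega> $ d $ w * cnj (?W \<omega> $ a $ x) * cnj (?W \<omega> $ b $ y) =
        (\<Prod>m\<in>UNIV. f m (U (Suc n) m \<omega>))" for \<omega>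
      by (simp add: tensor_def f_def prod.distrib)
    have "(\<integral>\<omega>. ?W \<omega> $ c $ z * ?W \<omega> $ d $ w * cnj (?W \<omega> $ a $ x) * cnj (?W \<omega> $ b $ y) *
        (\<tau> \<omega> $ z $ x * \<tau> \<omega> $ w $ y) \<partial>P) =
      (\<Prod>m\<in>UNIV. \<integral>\<omega>. f m (U (Suc n) m \<omega>) \<partial>P) * (\<integral>\<omega>. \<tau> \<omega> $ z $ x * \<tau> \<omega> $ w $ y \<partial>P)"
      unfolding prod \<tau>_def
    proof (rule expectation_fresh_layer[OF P ind, where F = "\<lambda>x'. t x' $ z $ x * t x' $ w $ y"])
      show "f m \<in> borel_measurable borel" for m
        unfolding f_def by (rule borel_measurable_continuous_onI) (intro continuous_intros)
      show "(\<lambda>x'. t x' $ z $ x * t x' $ w $ y) \<in> borel_measurable (PiM ({1..n} \<times> UNIV) (\<lambda>_. borel))"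
        by (intro borel_measurable_times meas)
      show "integrable P (\<lambda>\<omega>. f m (U (Suc n) m \<omega>))" for m
        unfolding f_def by (intro bounded_rv_integrable[OF fin] bounded_rv_mult bounded_rv_cnj bU)
      show "integrable P (\<lambda>\<omega>. t (\<lambda>(l, m)\<in>{1..n} \<times> UNIV. U l m \<omega>) $ z $ x *
          t (\<lambda>(l, m)\<in>{1..n} \<times> UNIV. U l m \<omega>) $ w $ y)"
        by (intro bounded_rv_integrable[OF fin] bounded_rv_mult bdd)
    qed
    also have "(\<Prod>m\<in>UNIV. \<integral>\<omega>. f m (U (Suc n) m \<omega>) \<partial>P) =
      (\<Prod>m\<in>UNIV. \<Sum>k\<in>UNIV.
        factor_kernel (grp g m) k (c \<inter> grp g m) (d \<inter> grp g m) (a \<inter> grp g m) (b \<inter> grp g m) *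
        factor_kernel (grp g m) k (z \<inter> grp g m) (w \<inter> grp g m) (x \<inter> grp g m) (y \<inter> grp g m) /
        factor_dim (grp g m) k)"
      unfolding f_def by (intro prod.cong refl unitary_2_design_moment[OF P des ne]) auto
    \<comment> \<open>Choosing true or false in every factor amounts to choosing
      \<open>\<kappa>\<close>; kernels and dimensions multiply accordingly.\<close>
    also have "\<dots> = (\<Sum>\<kappa>\<in>UNIV. loc_kernel g \<kappa> c d a b * loc_kernel g \<kappa> z w x y / of_nat (loc_dim g \<kappa>))"
      unfolding sum_prod_bool_fun by (simp only: loc_kernel_def of_nat_loc_dim prod.distrib prod_dividef)
    finally show ?thesis .
  qed
  have bW: "bounded_rv P (\<lambda>\<omega>. ?W \<omega> $ i $ j)" for i j
    unfolding tensor_def vec_lambda_beta by (intro bounded_rv_prod bU)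
  have b1: "bounded_rv P (\<lambda>\<omega>. H $ a $ c * H $ b $ d *
      (?W \<omega> $ c $ z * ?W \<omega> $ d $ w * cnj (?W \<omega> $ a $ x) * cnj (?W \<omega> $ b $ y) *
      (\<tau> \<omega> $ z $ x * \<tau> \<omega> $ w $ y)))" for a b c d w x y z
    by (intro bounded_rv_mult bounded_rv_const bounded_rv_cnj bW b\<tau>)
  have b2: "bounded_rv P (\<lambda>\<omega>. loc_kernel g \<kappa> z w x y * (\<tau> \<omega> $ z $ x * \<tau> \<omega> $ w $ y))" for \<kappa> w x y z
    by (intro bounded_rv_mult bounded_rv_const b\<tau>)
  have loc\<tau>: "(\<integral>\<omega>. locality_vector g (\<tau> \<omega>) $ \<kappa> \<partial>P) = (\<Sum>r\<in>UNIV. \<Sum>s\<in>UNIV.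
      loc_kernel g \<kappa> (fst r) (fst s) (snd r) (snd s) *
      (\<integral>\<omega>. \<tau> \<omega> $ fst r $ snd r * \<tau> \<omega> $ fst s $ snd s \<partial>P))" for \<kappa>
    unfolding locality_vector_kernel' split_def
    by (simp only: Bochner_Integration.integral_sum Bochner_Integration.integrable_sum
        bounded_rv_integrable[OF fin b2] integral_mult_right_zero)
  have "(\<integral>\<omega>. (trace (conjugation (?W \<omega>) (\<tau> \<omega>) ** H))\<^sup>2 \<partial>P) =
    (\<Sum>p\<in>UNIV. \<Sum>q\<in>UNIV. \<Sum>r\<in>UNIV. \<Sum>s\<in>UNIV.
      H $ snd p $ fst p * H $ snd q $ fst q *
      ((\<Sum>\<kappa>\<in>UNIV. loc_kernel g \<kappa> (fst p) (fst q) (snd p) (snd q) *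
        loc_kernel g \<kappa> (fst r) (fst s) (snd r) (snd s) / of_nat (loc_dim g \<kappa>)) *
      (\<integral>\<omega>. \<tau> \<omega> $ fst r $ snd r * \<tau> \<omega> $ fst s $ snd s \<partial>P)))"
    unfolding trace_conjugation_square split_def
    by (simp only: Bochner_Integration.integral_sum Bochner_Integration.integrable_sum
        bounded_rv_integrable[OF fin b1] integral_mult_right_zero moment)
  also have "\<dots> = (\<Sum>\<kappa>\<in>UNIV. locality_vector g H $ \<kappa> / of_nat (loc_dim g \<kappa>) *
      (\<integral>\<omega>. locality_vector g (\<tau> \<omega>) $ \<kappa> \<partial>P))"
    unfolding loc\<tau> unfolding locality_vector_kernel split_def by (rule sum_bilinear_factor)
  finally show ?thesis .
qed


section \<open>Layered channels\<close>

text \<open>Applied with measurability and with boundedness for \<open>Q\<close>.\<close>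

lemma layered_closed:
  fixes Q :: "('x \<Rightarrow> complex) \<Rightarrow> bool" and V :: "'x \<Rightarrow> nat \<Rightarrow> complex^'n^'n"
  assumes const: "\<And>c. Q (\<lambda>_. c)"
    and add: "\<And>f h. Q f \<Longrightarrow> Q h \<Longrightarrow> Q (\<lambda>x. f x + h x)"
    and mult: "\<And>f h. Q f \<Longrightarrow> Q h \<Longrightarrow> Q (\<lambda>x. f x * h x)"
    and cnj: "\<And>f. Q f \<Longrightarrow> Q (\<lambda>x. cnj (f x))"
    and V: "\<And>l i j. l \<in> {1..Suc n} \<Longrightarrow> Q (\<lambda>x. V x l $ i $ j)"
    and lin: "\<And>l. l \<in> {1..n} \<Longrightarrow> linear_map (\<E> l)"
  shows "Q (\<lambda>x. layered \<E> (V x) n \<rho> $ i $ j)"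
proof -
  have sum: "Q (\<lambda>x. \<Sum>i\<in>I. f i x)" if "\<And>i. Q (f i)" for I :: "'n set" and f :: "'n \<Rightarrow> 'x \<Rightarrow> complex"
    using that by (induction I rule: infinite_finite_induct) (auto intro: const add)
  have conj: "Q (\<lambda>x. conjugation (W x) (A x) $ i $ j)"
    if "\<And>i j. Q (\<lambda>x. W x $ i $ j)" "\<And>i j. Q (\<lambda>x. A x $ i $ j)" for W A :: "'x \<Rightarrow> complex^'n^'n" and i j
    unfolding conjugation_def matrix_matrix_mult_def dagger_def cconj_def transpose_def vec_lambda_beta
    by (intro sum mult cnj that)
  show ?thesis
    using V lin
  proof (induction n arbitrary: i j)
    case 0
    then show ?case by (auto intro!: conj const)
  next
    case (Suc n)
    have "Q (\<lambda>x. \<E> (Suc n) (layered \<E> (V x) n \<rho>) $ i $ j)" for i j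
    proof -
      have "linear_map (\<E> (Suc n))" using Suc.prems by simp
      from linear_map_entry[OF this]
      have eq: "(\<lambda>x. \<E> (Suc n) (layered \<E> (V x) n \<rho>) $ i $ j) =
          (\<lambda>x. \<Sum>k\<in>UNIV. \<Sum>l\<in>UNIV. layered \<E> (V x) n \<rho> $ k $ l * \<E> (Suc n) (unit_matrix k l) $ i $ j)"
        by (rule ext)
      show ?thesis
        unfolding eq by (intro sum mult const Suc.IH) (use Suc.prems in auto)
    qed
    moreover have "Q (\<lambda>x. V x (n + 2) $ i $ j)" for i j
      using Suc.prems by simp
    ultimately show ?case by (auto intro!: conj)
  qed
qed

section \<open>Transfer matrices and induction over the layers\<close>

lemma layered_cong:
  "(\<And>l. l \<in> {1..Suc n} \<Longrightarrow> V l = W l) \<Longrightarrow> layered \<E> V n = layered \<E> W n"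
  by (induction n) auto

text \<open>The induction adds a layer at the end, hence a transfer matrix on the right, whereas
  \<open>foldr\<close> unfolds from the left.\<close>

lemma foldr_matrix_mult_snoc:
  fixes T :: "complex^'n^'n"
  shows "foldr (**) (Ts @ [T]) (mat 1) = foldr (**) Ts (mat 1) ** T"
  by (induction Ts) (simp_all add: matrix_mul_assoc)

lemma loc_inner_matrix_vector:
  "loc_inner g a (M *v v) = (\<Sum>j\<in>UNIV. (\<Sum>\<kappa>\<in>UNIV. a $ \<kappa> * M $ \<kappa> $ j / of_nat (loc_dim g \<kappa>)) * v $ j)"
proof -
  have "loc_inner g a (M *v v) = (\<Sum>\<kappa>\<in>UNIV. \<Sum>j\<in>UNIV. a $ \<kappa> * M $ \<kappa> $ j / of_nat (loc_dim g \<kappa>) * v $ j)"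
    by (simp add: loc_inner_def matrix_vector_mult_def sum_distrib_left sum_divide_distrib mult.assoc)
  then show ?thesis
    by (subst (asm) sum.swap) (simp only: sum_distrib_right)
qed

text \<open>Column \<open>\<nu>\<close> of the transfer matrix is the average of the locality
  vectors of \<open>\<Lambda> B\<close> over the basis, and the remaining expression is linear in
  that column. The right-hand side is what the last twirl produces.\<close>

lemma loc_inner_ltm:
  "loc_inner g a (M *v (ltm g \<Lambda> *v h)) =
    (\<Sum>\<nu>\<in>UNIV. h $ \<nu> / of_nat (loc_dim g \<nu>) *
      (\<Sum>B\<in>herm_basis g \<nu>. loc_inner g a (M *v locality_vector g (\<Lambda> B))))"
proof -
  define w where "w j = (\<Sum>\<kappa>\<in>UNIV. a $ \<kappa> * M $ \<kappa> $ j / of_nat (loc_dim g \<kappa>))" for j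
  let ?f = "\<lambda>j \<nu> B. h $ \<nu> / of_nat (loc_dim g \<nu>) * (w j * locality_vector g (\<Lambda> B) $ j)"
  have "loc_inner g a (M *v (ltm g \<Lambda> *v h)) = (\<Sum>j\<in>UNIV. \<Sum>\<nu>\<in>UNIV. \<Sum>B\<in>herm_basis g \<nu>. ?f j \<nu> B)"
    unfolding loc_inner_matrix_vector w_def[symmetric]
    by (simp add: matrix_vector_mult_def ltm_def sum_distrib_left sum_distrib_right sum_divide_distrib mult_ac)
  also have "\<dots> = (\<Sum>\<nu>\<in>UNIV. \<Sum>j\<in>UNIV. \<Sum>B\<in>herm_basis g \<nu>. ?f j \<nu> B)"
    by (rule sum.swap)
  also have "\<dots> = (\<Sum>\<nu>\<in>UNIV. \<Sum>B\<in>herm_basis g \<nu>. \<Sum>j\<in>UNIV. ?f j \<nu> B)"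
    by (intro sum.cong refl sum.swap)
  finally show ?thesis
    unfolding loc_inner_matrix_vector w_def[symmetric] by (simp only: sum_distrib_left)
qed

lemma layered_moment:
  fixes g :: "'q::finite \<Rightarrow> 'm::finite" and U :: "nat \<Rightarrow> 'm \<Rightarrow> 'w \<Rightarrow> 'q qop"
  assumes g: "surj g" and P: "prob_space P"
    and chan: "\<And>l. l \<in> {1..L} \<Longrightarrow> quantum_channel (\<E> l)"
    and ind: "prob_space.indep_vars P (\<lambda>_. borel) (\<lambda>(l, m). U l m) ({1..Suc L} \<times> UNIV)"
    and des: "\<And>l m. l \<in> {1..Suc L} \<Longrightarrow> unitary_2_design (grp g m) P (U l m)"
  shows "(\<integral>\<omega>. (trace (layered \<E> (\<lambda>l. tensor g (\<lambda>m. U l m \<omega>)) L \<rho> ** H))\<^sup>2 \<partial>P) =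
    loc_inner g (locality_vector g \<rho>)
      (foldr (**) (map (\<lambda>l. ltm g (hs_adjoint (\<E> l))) [1..<L + 1]) (mat 1) *v locality_vector g H)"
  using chan ind des
proof (induction L arbitrary: H)
  case 0
  interpret prob_space P by (rule P)
  \<comment> \<open>Without channels the operator before the only twirl is the constant
    \<open>\<rho>\<close>, and the set of earlier layers is empty.\<close>
  have "(\<integral>\<omega>. (trace (conjugation (tensor g (\<lambda>m. U (Suc 0) m \<omega>)) \<rho> ** H))\<^sup>2 \<partial>P) =
    (\<Sum>\<kappa>\<in>UNIV. locality_vector g H $ \<kappa> / of_nat (loc_dim g \<kappa>) * (\<integral>\<omega>. locality_vector g \<rho> $ \<kappa> \<partial>P))"
    using twirl_expectation[OF g P "0.prems"(2), where t = "\<lambda>_. \<rho>"] "0.prems"(3) by auto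
  then show ?case
    by (simp add: loc_inner_def prob_space mult.commute)
next
  case (Suc L)
  let ?V = "\<lambda>\<omega> l. tensor g (\<lambda>m. U l m \<omega>)"
  let ?Vx = "\<lambda>x l. tensor g (\<lambda>m. x (l, m))"
  let ?I = "{1..Suc L} \<times> (UNIV :: 'm set)"
  let ?\<sigma> = "\<lambda>\<omega>. layered \<E> (?V \<omega>) L \<rho>"
  let ?\<Lambda> = "hs_adjoint (\<E> (Suc L))"
  let ?T = "foldr (**) (map (\<lambda>l. ltm g (hs_adjoint (\<E> l))) [1..<L + 1]) (mat 1)"
  \<comment> \<open>The output of the last channel as a function of the tuple x of earlier
    unitaries: these are the layers 1 to L + 1, and the fresh layer is L + 2.\<close>
  define t where "t x = \<E> (Suc L) (layered \<E> (?Vx x) L \<rho>)" for x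
  have chan: "quantum_channel (\<E> l)" and lin: "linear_map (\<E> l)" if "l \<in> {1..Suc L}" for l
    using Suc.prems(1) that by (auto simp: quantum_channel_def)
  have entry: "\<E> (Suc L) A $ i $ j = (\<Sum>k\<in>UNIV. \<Sum>l\<in>UNIV. A $ k $ l * \<E> (Suc L) (unit_matrix k l) $ i $ j)"
    for A i j
    by (rule linear_map_entry[OF lin]) auto
  \<comment> \<open>Restriction to \<open>?I\<close> leaves layers beyond L + 1 undefined, but
    \<open>layered\<close> with L channels reads none of them.\<close>
  have restr: "t (\<lambda>(l, m)\<in>?I. U l m \<omega>) = \<E> (Suc L) (?\<sigma> \<omega>)" for \<omega>
    unfolding t_def by (subst layered_cong[of L _ "?V \<omega>"]) auto
  have meas: "(\<lambda>x. t x $ i $ j) \<in> borel_measurable (PiM ?I (\<lambda>_. borel))" for i j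
  proof -
    have "(\<lambda>x. layered \<E> (?Vx x) L \<rho> $ i $ j) \<in> borel_measurable (PiM ?I (\<lambda>_. borel))" for i j
    proof (rule layered_closed[where Q = "\<lambda>f. f \<in> borel_measurable (PiM ?I (\<lambda>_. borel))"])
      fix f :: "(nat \<times> 'm \<Rightarrow> 'q qop) \<Rightarrow> complex"
      assume "f \<in> borel_measurable (PiM ?I (\<lambda>_. borel))"
      then show "(\<lambda>x. cnj (f x)) \<in> borel_measurable (PiM ?I (\<lambda>_. borel))"
        by (rule borel_measurable_continuous_on[OF continuous_on_cnj[OF continuous_on_id]])
    next
      fix l i j assume "l \<in> {1..Suc L}"
      then show "(\<lambda>x. ?Vx x l $ i $ j) \<in> borel_measurable (PiM ?I (\<lambda>_. borel))"
        unfolding tensor_def vec_lambda_beta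
        by (intro borel_measurable_prod measurable_entry measurable_component_singleton) auto
    qed (use lin in auto)
    then show ?thesis
      unfolding t_def by (subst entry) (intro borel_measurable_sum borel_measurable_times borel_measurable_const)
  qed
  have b\<sigma>: "bounded_rv P (\<lambda>\<omega>. ?\<sigma> \<omega> $ i $ j)" for i j
  proof (rule layered_closed[where Q = "bounded_rv P"])
    fix l i j assume l: "l \<in> {1..Suc L}"
    have "bounded_rv P (\<lambda>\<omega>. U l m \<omega> $ i $ j)" for m i j
      by (rule bounded_rv_unitary_entry[where S = "grp g m"])
        (use Suc.prems(3)[of l m] l in \<open>auto simp: unitary_2_design_def\<close>)
    then show "bounded_rv P (\<lambda>\<omega>. ?V \<omega> l $ i $ j)"
      unfolding tensor_def vec_lambda_beta by (intro bounded_rv_prod)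
  qed (use lin in auto)
  have bt: "bounded_rv P (\<lambda>\<omega>. \<E> (Suc L) (?\<sigma> \<omega>) $ i $ j)" for i j
    by (subst entry) (intro bounded_rv_sum bounded_rv_mult b\<sigma> bounded_rv_const)
  \<comment> \<open>The hypothesis is kept for every observable, since it is used at
    \<open>?\<Lambda> B\<close> for all basis operators B.\<close>
  have IH: "(\<integral>\<omega>. (trace (?\<sigma> \<omega> ** H))\<^sup>2 \<partial>P) = loc_inner g (locality_vector g \<rho>) (?T *v locality_vector g H)" for H
  proof (rule Suc.IH)
    show "prob_space.indep_vars P (\<lambda>_. borel) (\<lambda>(l, m). U l m) ?I"
      by (rule prob_space.indep_vars_subset[OF P Suc.prems(2)]) auto
  qed (use Suc.prems in auto)
  have step: "(\<integral>\<omega>. locality_vector g (\<E> (Suc L) (?\<sigma> \<omega>)) $ \<kappa> \<partial>P) =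
    (\<Sum>B\<in>herm_basis g \<kappa>. loc_inner g (locality_vector g \<rho>) (?T *v locality_vector g (?\<Lambda> B)))" for \<kappa>
  proof -
    have "integrable P (\<lambda>\<omega>. (trace (B ** \<E> (Suc L) (?\<sigma> \<omega>)))\<^sup>2)" for B
      unfolding trace_mult_pairs split_def power2_eq_square
      by (intro bounded_rv_integrable bounded_rv_mult bounded_rv_sum bounded_rv_const bt)
        (use P in \<open>simp add: prob_space_def\<close>)
    then have "(\<integral>\<omega>. locality_vector g (\<E> (Suc L) (?\<sigma> \<omega>)) $ \<kappa> \<partial>P) =
        (\<Sum>B\<in>herm_basis g \<kappa>. \<integral>\<omega>. (trace (B ** \<E> (Suc L) (?\<sigma> \<omega>)))\<^sup>2 \<partial>P)"
      by (simp add: locality_vector_def)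
    also have "\<dots> = (\<Sum>B\<in>herm_basis g \<kappa>. \<integral>\<omega>. (trace (?\<sigma> \<omega> ** ?\<Lambda> B))\<^sup>2 \<partial>P)"
    proof (rule sum.cong[OF refl])
      fix B assume "B \<in> herm_basis g \<kappa>"
      then have "dagger B = B"
        using hermitian_onb_herm_basis[of g \<kappa>] by (simp add: hermitian_onb_def)
      then have "trace (B ** \<E> (Suc L) A) = trace (A ** ?\<Lambda> B)" for A
        by (intro trace_hs_adjoint chan) auto
      then show "(\<integral>\<omega>. (trace (B ** \<E> (Suc L) (?\<sigma> \<omega>)))\<^sup>2 \<partial>P) = (\<integral>\<omega>. (trace (?\<sigma> \<omega> ** ?\<Lambda> B))\<^sup>2 \<partial>P)"
        by simp
    qed
    finally show ?thesis unfolding IH .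
  qed
  have "(\<integral>\<omega>. (trace (layered \<E> (?V \<omega>) (Suc L) \<rho> ** H))\<^sup>2 \<partial>P) =
      (\<Sum>\<kappa>\<in>UNIV. locality_vector g H $ \<kappa> / of_nat (loc_dim g \<kappa>) *
        (\<integral>\<omega>. locality_vector g (\<E> (Suc L) (?\<sigma> \<omega>)) $ \<kappa> \<partial>P))"
    using twirl_expectation[OF g P Suc.prems(2), where t = t and H = H, unfolded restr] meas bt Suc.prems(3)
    by simp
  also have "\<dots> = loc_inner g (locality_vector g \<rho>) (?T *v (ltm g ?\<Lambda> *v locality_vector g H))"
    unfolding step by (rule loc_inner_ltm[symmetric])
  also have "?T *v (ltm g ?\<Lambda> *v locality_vector g H) =
      foldr (**) (map (\<lambda>l. ltm g (hs_adjoint (\<E> l))) [1..<Suc L + 1]) (mat 1) *v locality_vector g H"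
  proof -
    have "map (\<lambda>l. ltm g (hs_adjoint (\<E> l))) [1..<Suc L + 1] =
        map (\<lambda>l. ltm g (hs_adjoint (\<E> l))) [1..<L + 1] @ [ltm g ?\<Lambda>]"
      by simp
    then show ?thesis
      by (simp only: foldr_matrix_mult_snoc matrix_vector_mul_assoc)
  qed
  finally show ?case .
qed

theorem mainTheorem3:
  fixes g :: "'q::finite \<Rightarrow> 'm::finite"
    and P :: "'w measure"
    and U :: "nat \<Rightarrow> 'm \<Rightarrow> 'w \<Rightarrow> 'q qop"
    and \<E> :: "nat \<Rightarrow> 'q qop \<Rightarrow> 'q qop"
    and L :: nat
    and \<rho> H :: "'q qop"
  assumes "surj g"
    and "prob_space P"
    and "\<And>l. l \<in> {1..L} \<Longrightarrow> quantum_channel (\<E> l)"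
    and "prob_space.indep_vars P (\<lambda>_. borel) (\<lambda>(l, m). U l m) ({1..L + 1} \<times> UNIV)"
    and "\<And>l m. l \<in> {1..L + 1} \<Longrightarrow> unitary_2_design (grp g m) P (U l m)"
  shows "prob_space.expectation P
      (\<lambda>\<omega>. (trace (layered \<E> (\<lambda>l. tensor g (\<lambda>m. U l m \<omega>)) L \<rho> ** H))\<^sup>2)
    = loc_inner g (locality_vector g \<rho>)
        (foldr (**) (map (\<lambda>l. ltm g (hs_adjoint (\<E> l))) [1..<L + 1]) (mat 1)
          *v locality_vector g H)"
  using layered_moment[of g P L \<E> U \<rho> H] assms by (simp only: Suc_eq_plus1)

end
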